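(* For every real $p$ with $0<|p|<1$, $$\frac{2\pi^2}{1-e^{-2\pi p}}\int_0^1 e^{-2\pi p x}\,\zeta'(0,x)\,dx=\left[\log(2\pi)+\gamma\right]\sum_{n=0}^\infty(-1)^n\zeta(2n+2)p^{2n}+\frac{\pi}{2}\sum_{n=0}^\infty(-1)^n\zeta(2n+3)p^{2n+1}-\sum_{n=0}^\infty(-1)^n\zeta'(2n+2)p^{2n}.$$
   Context: $\zeta(s,x)$ is the Hurwitz zeta function, $\zeta'(s,x)=\frac{\partial}{\partial s}\zeta(s,x)$, so $\zeta'(0,x)=\frac{\partial}{\partial s}\zeta(s,x)\big|_{s=0}$; $\zeta(s)$ is the Riemann zeta function with derivative $\zeta'(s)$; $\gamma$ is Euler's constant. *)

theory Defs
  imports "HOL-Complex_Analysis.Complex_Analysis"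
begin

text \<open>
  The Hurwitz zeta function \<open>\<zeta>(s, x)\<close>, for real \<open>x > 0\<close>, is the analytic continuation in \<open>s\<close>
  of \<open>\<Sum>n. (n + x) powr - s\<close> from the half-plane \<open>Re s > 1\<close> to the plane punctured at \<open>1\<close>; the
  continuation is unique by the identity theorem. The value at the pole is set to \<open>0\<close> only so
  that the description determines a function on the whole type. Note the order of the arguments.
  The function has no intended meaning for \<open>x \<le> 0\<close>.
\<close>

definition hurwitz_zeta :: "real \<Rightarrow> complex \<Rightarrow> complex" where
  "hurwitz_zeta x = (THE f. f holomorphic_on - {1} \<and>
     (\<forall>s. Re s > 1 \<longrightarrow> f s = (\<Sum>n. (of_nat n + of_real x) powr - s)) \<and> f 1 = 0)"

text \<open>Since the sum above starts at \<open>n = 0\<close>, \<open>\<zeta>(s) = \<zeta>(s, 1)\<close>.\<close>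

definition zeta :: "complex \<Rightarrow> complex" where
  "zeta s = hurwitz_zeta 1 s"

end

theory Submission
  imports Defs
begin

text \<open>
  Evaluate \<open>\<zeta>'(0, x)\<close> by Binet's formula as \<open>x ln x - x - ln x / 2 + B(x)\<close>, where
  \<open>B(x) = \<Sum>n. (x + n + 1/2) ln (1 + 1/(x + n)) - 1\<close> is the Laplace transform of
  \<open>k(t) = \<Sum>n\<ge>1. 2 / (t\<^sup>2 + (2\<pi>n)\<^sup>2)\<close>. For \<open>a > 0\<close> the relation
  \<open>\<zeta>'(0, x + 1) = \<zeta>'(0, x) + ln x\<close> turns the integral of \<open>exp (-ax) \<zeta>'(0, x)\<close> over \<open>[0, 1]\<close> into
  \<open>1 - exp (-a)\<close> times the Laplace transform over \<open>[0, \<infinity>)\<close> minus an elementary term. Term by term,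
  \<open>k\<close> contributes the integrals of \<open>2 / ((a + t) (t\<^sup>2 + c\<^sup>2))\<close> with \<open>c = 2\<pi>n\<close>, which produce
  \<open>ln c\<close> and \<open>\<pi>a / 2c\<close>; the terms in \<open>ln a\<close> cancel by the partial fractions of \<open>coth\<close>. Expanding
  \<open>1 / (n\<^sup>2 + p\<^sup>2)\<close> geometrically gives the claim for \<open>0 < p < 1\<close>, and both sides
  are holomorphic in the disc \<open>|p| < 1\<close> after multiplication by \<open>1 - exp (-2\<pi>p)\<close>.

  The continuation of \<open>\<zeta>(s, x)\<close> itself is obtained half-plane by half-plane from
  \<open>\<zeta>(s, x) = x powr (1 - s) / (s - 1) + s \<integral>\<^sub>0\<^sup>1 (1 - t) \<zeta>(s + 1, x + t) dt\<close>.
\<close>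

section \<open>Analytic continuation of the Hurwitz zeta function\<close>

text \<open>The definition by \<open>THE\<close> is what makes the continuation long. Only
  neighbourhoods of s = 0 and of the integers s >= 2 matter for the theorem, and there the explicit
  quotient \<open>em_zeta s x / (s - 1)\<close> is enough; but \<open>hurwitz_zeta\<close> is known
  to equal it only once a holomorphic function on the whole punctured plane has been shown to exist.
  The recursion supplies this existence. The interchanges behind Binet's formula and its Laplace
  transform are made for nonnegative integrals: Tonelli then asks for no prior integrability, and a
  finite value yields it. The price is a proof of sign for each ingredient, since
  \<open>ennreal\<close> truncates negative numbers to 0. The integral over the half-line diverges
  for a <= 0, because the function grows like x ln x. Negative p is therefore beyond the direct
  computation, and this is why the parameter becomes complex.\<close>

lemma norm_of_real_powr: "y > 0 \<Longrightarrow> norm (of_real y powr (s::complex)) = y powr Re s"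
  by (simp add: norm_powr_real_powr)

lemma continuous_on_of_real_powr:
  assumes "\<And>z. z \<in> A \<Longrightarrow> f z > 0" "continuous_on A f" "continuous_on A g"
  shows "continuous_on A (\<lambda>z. of_real (f z) powr (g z :: complex))"
  by (intro continuous_on_powr_complex continuous_on_of_real assms(2,3))
     (use assms(1) in \<open>force simp: less_imp_le\<close>)+

lemma has_vector_derivative_of_real_powr:
  assumes "y + v > 0"
  shows "((\<lambda>v. of_real (y + v) powr (s::complex)) has_vector_derivative
           s * of_real (y + v) powr (s - 1)) (at v within A)"
proof -
  have "((\<lambda>z. (of_real y + z) powr s) has_field_derivative s * (of_real y + of_real v) powr (s - 1))
          (at (of_real v))"
  proof (rule DERIV_chain'[of "\<lambda>z. of_real y + z" 1 _ _ "\<lambda>w. w powr s", simplified])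
    have "of_real y + of_real v = (of_real (y + v) :: complex)" by simp
    thus "((\<lambda>w. w powr s) has_field_derivative s * (of_real y + of_real v) powr (s - 1)) 
            (at (of_real y + of_real v))"
      using assms by (intro has_field_derivative_powr) (auto simp: complex_nonpos_Reals_iff)
  qed (auto intro!: derivative_eq_intros)
  from has_vector_derivative_real_field[OF this, of A] show ?thesis by simp
qed

text \<open>The mean value theorem as an inequality, since the equality fails for complex values.
  Two nested applications turn a bound on a second derivative into a bound on the trapezoidal
  error.\<close>

lemma vector_increment_bound:
  fixes f :: "real \<Rightarrow> 'a::real_inner"
  assumes "\<And>v. v \<in> {0..1} \<Longrightarrow> (f has_vector_derivative f' v) (at v)"
    and "\<And>v. v \<in> {0..1} \<Longrightarrow> norm (f' v) \<le> B" and "u \<in> {0..1}"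
  shows "norm (f u - f 0) \<le> B"
proof (cases "u = 0")
  case True
  have "norm (f' 0) \<le> B" using assms(2)[of 0] by simp
  hence "0 \<le> B" using norm_ge_zero[of "f' 0"] by linarith
  thus ?thesis using True by simp
next
  case False
  hence "u > 0" using assms(3) by auto
  have "\<exists>x\<in>{0<..<u}. norm (f u - f 0) \<le> norm ((\<lambda>h. h *\<^sub>R f' x) (u - 0))"
  proof (rule mvt_general[OF \<open>u > 0\<close>])
    show "continuous_on {0..u} f"
      using assms(1,3) by (intro continuous_at_imp_continuous_on ballI)
        (meson atLeastAtMost_iff has_vector_derivative_continuous order_trans)
    show "(f has_derivative (\<lambda>h. h *\<^sub>R f' x)) (at x)" if "0 < x" "x < u" for x
      using assms(1)[of x] assms(3) that unfolding has_vector_derivative_def by auto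
  qed
  then obtain x where x: "x \<in> {0<..<u}" "norm (f u - f 0) \<le> u * norm (f' x)"
    using \<open>u > 0\<close> by auto
  have "u * norm (f' x) \<le> 1 * norm (f' x)" using assms(3) by (intro mult_right_mono) auto
  also have "\<dots> \<le> B" using assms(2)[of x] x assms(3) by auto
  finally show ?thesis using x by linarith
qed

text \<open>
  Up to the factor \<open>s - 1\<close>, this is the error of the trapezoidal rule for the integral of
  \<open>t powr - s\<close> over \<open>[y, y + 1]\<close>; the factor makes it entire in \<open>s\<close>.
\<close>
definition trapezoid_error :: "complex \<Rightarrow> real \<Rightarrow> complex" where
  "trapezoid_error s y = (s - 1) / 2 * (of_real y powr -s + of_real (y + 1) powr -s) +
     of_real (y + 1) powr (1 - s) - of_real y powr (1 - s)"

text \<open>The rule is exact on affine functions, so the error is governed by the second derivative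
  \<open>s * (s + 1) * t powr (-s - 2)\<close>. Along y = x + n this bound is summable when Re s >
  -1. The condition Re s >= -2 makes the real power decreasing, so that the left end point
  dominates.\<close>

lemma norm_trapezoid_error_le:
  assumes y: "y > 0" and s: "Re s \<ge> -2"
  shows "norm (trapezoid_error s y) \<le> norm (s - 1) * norm (s * (s + 1)) * y powr (- Re s - 2)"
proof -
  \<comment> \<open>\<open>f v - f 0\<close> is the scaled error on [y, y + v], and its derivative
    is (s - 1) / 2 times \<open>c v\<close>. Here \<open>c 0 = 0\<close> and the derivative of
    \<open>c\<close> is \<open>s * (s + 1) * v * (y + v) powr (-s - 2)\<close>, which is bounded
    directly.\<close>
  define c where "c = (\<lambda>v. of_real y powr -s - of_real (y + v) powr -s - 
                           s * of_real v * of_real (y + v) powr (-s - 1))"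
  define f where "f = (\<lambda>v. (s - 1) / 2 * of_real v * (of_real y powr -s + of_real (y + v) powr -s) + 
                           of_real (y + v) powr (1 - s))"
  have "norm (c v) \<le> norm (s * (s + 1)) * y powr (- Re s - 2)" if v: "v \<in> {0..1}" for v
  proof -
    have "norm (c v - c 0) \<le> norm (s * (s + 1)) * y powr (- Re s - 2)"
    proof (rule vector_increment_bound[OF _ _ v])
      fix v :: real assume v: "v \<in> {0..1}"
      define P where "P = (of_real (y + v) :: complex) powr (-s - 2)"
      have e: "-s - 1 - 1 = -s - 2" by simp
      note d = has_vector_derivative_of_real_powr[of y v "-s - 1" UNIV, unfolded e]
               has_vector_derivative_of_real_powr[of y v "-s" UNIV]
      have id: "(of_real has_vector_derivative (1::complex)) (at v)"
        using has_vector_derivative_of_real[OF DERIV_ident] by simp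
      have yv: "y + v > 0" using y v by auto
      have "(c has_vector_derivative 0 - (- s * of_real (y + v) powr (-s - 1)) - 
              (s * of_real v * ((-s - 1) * P) + s * 1 * of_real (y + v) powr (-s - 1))) (at v)"
        unfolding c_def P_def
        by (intro has_vector_derivative_diff has_vector_derivative_mult d[OF yv] id
              has_vector_derivative_const has_vector_derivative_mult_right)
      thus "(c has_vector_derivative s * (s + 1) * of_real v * P) (at v)"
        by (simp add: algebra_simps)
      have "norm P \<le> y powr (- Re s - 2)"
        unfolding P_def using y v s by (subst norm_of_real_powr) (auto intro!: powr_mono2')
      hence "norm (s * (s + 1)) * (\<bar>v\<bar> * norm P) \<le> norm (s * (s + 1)) * (1 * y powr (- Re s - 2))"
        using v by (intro mult_left_mono mult_mono) auto
      thus "norm (s * (s + 1) * of_real v * P) \<le> norm (s * (s + 1)) * y powr (- Re s - 2)"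
        by (simp add: norm_mult)
    qed
    thus ?thesis by (simp add: c_def)
  qed note c = this
  have "norm (f 1 - f 0) \<le> norm (s - 1) * (norm (s * (s + 1)) * y powr (- Re s - 2))"
  proof (rule vector_increment_bound[where u = 1])
    fix v :: real assume v: "v \<in> {0..1}"
    have e: "1 - s - 1 = - s" by simp
    note d = has_vector_derivative_of_real_powr[of y v "1-s" UNIV, unfolded e]
             has_vector_derivative_of_real_powr[of y v "-s" UNIV]
    have id: "(of_real has_vector_derivative (1::complex)) (at v)"
      using has_vector_derivative_of_real[OF DERIV_ident] by simp
    have yv: "y + v > 0" using y v by auto
    have "(f has_vector_derivative (s - 1) / 2 * of_real v * (0 + - s * of_real (y + v) powr (-s - 1)) + 
            (s - 1) / 2 * 1 * (of_real y powr -s + of_real (y + v) powr -s) + 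
            (1 - s) * of_real (y + v) powr -s) (at v)"
      unfolding f_def
      by (intro has_vector_derivative_add has_vector_derivative_mult d[OF yv] id
            has_vector_derivative_const has_vector_derivative_mult_right)
    also have "(s - 1) / 2 * of_real v * (0 + - s * of_real (y + v) powr (-s - 1)) + 
            (s - 1) / 2 * 1 * (of_real y powr -s + of_real (y + v) powr -s) + 
            (1 - s) * of_real (y + v) powr -s = (s - 1) / 2 * c v"
      unfolding c_def by (simp add: field_simps del: of_real_add)
    finally show "(f has_vector_derivative (s - 1) / 2 * c v) (at v)" .
    have "norm ((s - 1) / 2 * c v) = norm (s - 1) * (norm (c v) / 2)" by (simp add: norm_mult norm_divide)
    also have "\<dots> \<le> norm (s - 1) * (norm (s * (s + 1)) * y powr (- Re s - 2))"
    proof (intro mult_left_mono)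
      show "norm (c v) / 2 \<le> norm (s * (s + 1)) * y powr (- Re s - 2)"
        using c[OF v] norm_ge_zero[of "c v"] by linarith
    qed auto
    finally show "norm ((s - 1) / 2 * c v) \<le> norm (s - 1) * (norm (s * (s + 1)) * y powr (- Re s - 2))" .
  qed auto
  moreover have "f 1 - f 0 = trapezoid_error s y" by (simp add: f_def trapezoid_error_def)
  ultimately show ?thesis by (simp add: mult.assoc)
qed

text \<open>Interior nodes are shared by two intervals, so only the two end nodes keep the weight
  1/2; the integrals telescope.\<close>

lemma sum_trapezoid_error:
  "(\<Sum>n<N. trapezoid_error s (x + real n)) =
     (s - 1) * ((\<Sum>n<N. of_real (x + real n) powr -s) - of_real x powr -s / 2 
       + of_real (x + real N) powr -s / 2) + of_real (x + real N) powr (1 - s) - of_real x powr (1 - s)"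
proof -
  define P Q where "P = (\<lambda>n. of_real (x + real n) powr -s)" and "Q = (\<lambda>n. of_real (x + real n) powr (1 - s))"
  have "x + real n + 1 = x + real (Suc n)" for n by simp
  hence "trapezoid_error s (x + real n) = (s - 1) / 2 * (P n + P (Suc n)) + Q (Suc n) - Q n" for n
    unfolding trapezoid_error_def P_def Q_def by metis
  hence "(\<Sum>n<N. trapezoid_error s (x + real n)) = 
           (\<Sum>n<N. (s - 1) / 2 * (P n + P (Suc n)) + Q (Suc n) - Q n)"
    by simp
  also have "\<dots> = (s - 1) * ((\<Sum>n<N. P n) - P 0 / 2 + P N / 2) + Q N - Q 0"
  proof (induction N)
    case (Suc N)
    show ?case unfolding sum.lessThan_Suc Suc.IH by (simp add: field_simps)
  qed simp
  finally have "(\<Sum>n<N. trapezoid_error s (x + real n)) = 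
     (s - 1) * ((\<Sum>n<N. P n) - P 0 / 2 + P N / 2) + Q N - Q 0" .
  thus ?thesis by (simp add: P_def Q_def)
qed

text \<open>
  The Euler--Maclaurin formula of first order for \<open>(s - 1) * \<zeta>(s, x)\<close>; the series converges for
  \<open>Re s > - 1\<close> only.
\<close>
definition em_zeta :: "complex \<Rightarrow> real \<Rightarrow> complex" where
  "em_zeta s x = of_real x powr (1 - s) + (s - 1) / 2 * of_real x powr -s + 
     (\<Sum>n. trapezoid_error s (x + real n))"

text \<open>Weierstrass test, uniform in s and x together: dropping x > 0 from x + n gives a
  majorant in n alone for n >= 1, and \<open>norm s < R\<close> bounds the polynomial factor in
  s.\<close>

lemma uniform_limit_trapezoid_error:
  assumes "\<sigma> > -1"
  shows "uniform_limit ({s. Re s > \<sigma> \<and> norm s < R} \<times> {0<..})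
     (\<lambda>N (s, x). \<Sum>n<N. trapezoid_error s (x + real n)) 
     (\<lambda>(s, x). \<Sum>n. trapezoid_error s (x + real n)) sequentially"
proof -
  have "uniform_limit ({s. Re s > \<sigma> \<and> norm s < R} \<times> {0<..})
     (\<lambda>N z. \<Sum>n<N. trapezoid_error (fst z) (snd z + real n)) 
     (\<lambda>z. \<Sum>n. trapezoid_error (fst z) (snd z + real n)) sequentially"
  proof (rule Weierstrass_m_test_ev)
    show "summable (\<lambda>n. ((R + 1) * (R * (R + 1))) * real n powr (- \<sigma> - 2))"
      using assms by (intro summable_mult) (simp add: summable_real_powr_iff)
    show "\<forall>\<^sub>F n in sequentially. \<forall>z\<in>{s. \<sigma> < Re s \<and> cmod s < R} \<times> {0<..}. 
       norm (trapezoid_error (fst z) (snd z + real n)) \<le> (R + 1) * (R * (R + 1)) * real n powr (- \<sigma> - 2)"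
      using eventually_gt_at_top[of 0]
    proof eventually_elim
      case (elim n)
      show ?case
      proof safe
        fix s :: complex and x :: real
        assume s: "\<sigma> < Re s" "norm s < R" and x: "x > 0"
        have "R > 0" using s norm_ge_zero[of s] by linarith
        have a: "norm (s - 1) \<le> R + 1" "norm (s + 1) \<le> R + 1"
          using s norm_triangle_ineq4[of s 1] norm_triangle_ineq[of s 1] by auto
        have "norm (trapezoid_error s (x + real n)) \<le> norm (s - 1) * norm (s * (s + 1)) * (x + real n) powr (- Re s - 2)"
          using x assms s by (intro norm_trapezoid_error_le) auto
        also have "(x + real n) powr (- Re s - 2) \<le> real n powr (- Re s - 2)"
          using x elim assms s by (intro powr_mono2') auto
        also have "\<dots> \<le> real n powr (- \<sigma> - 2)"
          using elim s by (intro powr_mono) auto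
        also have "norm (s - 1) * norm (s * (s + 1)) * real n powr (- \<sigma> - 2) \<le>
          (R + 1) * (R * (R + 1)) * real n powr (- \<sigma> - 2)"
          using a s \<open>R > 0\<close> by (intro mult_mono) (auto simp: norm_mult intro!: mult_mono)
        finally show "norm (trapezoid_error (fst (s, x)) (snd (s, x) + real n)) \<le> 
          (R + 1) * (R * (R + 1)) * real n powr (- \<sigma> - 2)"
          by (simp add: mult_left_mono)
      qed
    qed
  qed
  thus ?thesis by (simp add: case_prod_unfold)
qed

lemma trapezoid_error_holomorphic: "y > 0 \<Longrightarrow> (\<lambda>s. trapezoid_error s y) holomorphic_on A"
  unfolding trapezoid_error_def by (intro holomorphic_intros) auto

lemma continuous_on_trapezoid_error:
  assumes "\<And>z. z \<in> A \<Longrightarrow> f z > 0" "continuous_on A f" "continuous_on A g"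
  shows "continuous_on A (\<lambda>z. trapezoid_error (g z) (f z))"
proof -
  have h: "continuous_on A (\<lambda>z. of_real (f z) powr h z :: complex)" 
          "continuous_on A (\<lambda>z. of_real (f z + 1) powr h z :: complex)" if "continuous_on A h" for h
    using assms(1) by (intro continuous_on_of_real_powr continuous_on_add assms(2) that continuous_on_const; force)+
  show ?thesis
    unfolding trapezoid_error_def
    by (intro continuous_on_add continuous_on_diff continuous_on_mult h) (auto intro!: continuous_intros assms)
qed

text \<open>Continuity is needed jointly in both variables, because the recursion integrates over
  the second one.\<close>

lemma continuous_on_em_zeta:
  "continuous_on ({s. Re s > -1} \<times> {0<..}) (\<lambda>(s, x). em_zeta s x)"
proof (rule continuous_at_imp_continuous_on, safe)
  fix s :: complex and x :: real
  assume s: "Re s > -1" and x: "x > 0"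
  define \<sigma> where "\<sigma> = (Re s - 1) / 2"
  define U :: "(complex \<times> real) set" where "U = {s'. Re s' > \<sigma> \<and> norm s' < norm s + 1} \<times> {0<..}"
  have \<sigma>: "\<sigma> > -1" "\<sigma> < Re s" using s by (auto simp: \<sigma>_def)
  have "continuous_on U (\<lambda>(s, x). \<Sum>n. trapezoid_error s (x + real n))"
    by (rule uniform_limit_theorem[OF _ uniform_limit_trapezoid_error[OF \<sigma>(1), of "norm s + 1", folded U_def]])
       (auto simp: U_def case_prod_unfold intro!: always_eventually continuous_intros continuous_on_trapezoid_error)
  hence "continuous_on U (\<lambda>z. \<Sum>n. trapezoid_error (fst z) (snd z + real n))"
    by (simp add: case_prod_unfold)
  hence "continuous_on U (\<lambda>z. em_zeta (fst z) (snd z))"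
    unfolding em_zeta_def
    by (intro continuous_intros) (auto simp: U_def complex_nonpos_Reals_iff)
  moreover have "open U" unfolding U_def
    by (intro open_Times open_Collect_conj open_Collect_less continuous_intros open_greaterThan)
  moreover have "(s, x) \<in> U" using x \<sigma> by (auto simp: U_def)
  ultimately show "isCont (\<lambda>(s, x). em_zeta s x) (s, x)"
    by (simp add: continuous_on_eq_continuous_at case_prod_unfold)
qed

text \<open>Locally uniform limits of holomorphic functions may be differentiated term by term. The
  second property keeps the differentiated series available for the evaluation at s = 0.\<close>

lemma em_zeta_has_field_derivative:
  assumes x: "x > 0"
  obtains D where "\<And>s. Re s > -1 \<Longrightarrow> ((\<lambda>s. em_zeta s x) has_field_derivative D s) (at s)"
    and "\<And>s. Re s > -1 \<Longrightarrow> (\<lambda>n. deriv (\<lambda>s. trapezoid_error s (x + real n)) s) sums 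
           (D s - deriv (\<lambda>s. of_real x powr (1 - s) + (s - 1) / 2 * of_real x powr -s) s)"
proof -
  let ?S = "{s::complex. Re s > -1}"
  let ?f = "\<lambda>n s. trapezoid_error s (x + real n)"
  let ?h = "\<lambda>s::complex. of_real x powr (1 - s) + (s - 1) / 2 * of_real x powr -s"
  have op: "open ?S" by (intro open_Collect_less continuous_intros)
  have "\<exists>g'. \<forall>s\<in>?S. ((\<lambda>s. \<Sum>n. ?f n s) has_field_derivative g' s) (at s) \<and> 
            (\<lambda>N. \<Sum>n<N. deriv (?f n) s) \<longlonglongrightarrow> g' s"
  proof (rule has_complex_derivative_uniform_sequence[OF op])
    fix N and s :: complex
    show "((\<lambda>s. \<Sum>n<N. ?f n s) has_field_derivative (\<Sum>n<N. deriv (?f n) s)) (at s)"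
    proof (rule DERIV_sum)
      fix n
      show "(?f n has_field_derivative deriv (?f n) s) (at s)"
        using x by (intro holomorphic_derivI[of _ UNIV] trapezoid_error_holomorphic) auto
    qed
  next
    fix s assume s: "s \<in> ?S"
    define \<sigma> where "\<sigma> = (Re s - 1) / 2"
    define U :: "complex set" where "U = {s'. Re s' > \<sigma> \<and> norm s' < norm s + 1}"
    have \<sigma>: "\<sigma> > -1" "\<sigma> < Re s" using s by (auto simp: \<sigma>_def)
    have "open U" unfolding U_def
      by (intro open_Collect_conj open_Collect_less continuous_intros)
    moreover have "s \<in> U" using \<sigma> by (auto simp: U_def)
    ultimately obtain d where d: "d > 0" "cball s d \<subseteq> U" by (meson open_contains_cball)
    have "uniform_limit U (\<lambda>N s. \<Sum>n<N. ?f n s) (\<lambda>s. \<Sum>n. ?f n s) sequentially"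
      using uniform_limit_compose'[OF uniform_limit_trapezoid_error[OF \<sigma>(1), of "norm s + 1"], of "\<lambda>s. (s, x)" U] x
      by (auto simp: U_def)
    hence "uniform_limit (cball s d) (\<lambda>N s. \<Sum>n<N. ?f n s) (\<lambda>s. \<Sum>n. ?f n s) sequentially"
      using d(2) by (rule uniform_limit_on_subset)
    moreover have "U \<subseteq> ?S" using \<sigma> by (auto simp: U_def)
    ultimately show "\<exists>d>0. cball s d \<subseteq> ?S \<and> 
        uniform_limit (cball s d) (\<lambda>N s. \<Sum>n<N. ?f n s) (\<lambda>s. \<Sum>n. ?f n s) sequentially"
      using d by blast
  qed
  then obtain g' where g': "\<And>s. Re s > -1 \<Longrightarrow> ((\<lambda>s. \<Sum>n. ?f n s) has_field_derivative g' s) (at s)"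
      "\<And>s. Re s > -1 \<Longrightarrow> (\<lambda>n. deriv (?f n) s) sums g' s"
    unfolding sums_def by blast
  have h: "(?h has_field_derivative deriv ?h s) (at s)" for s
    by (rule holomorphic_derivI[of _ UNIV]) (auto intro!: holomorphic_intros)
  show ?thesis
  proof (rule that[of "\<lambda>s. deriv ?h s + g' s"])
    fix s :: complex assume "Re s > -1"
    thus "((\<lambda>s. em_zeta s x) has_field_derivative deriv ?h s + g' s) (at s)"
      unfolding em_zeta_def by (intro DERIV_add[OF h g'(1)])
  qed (use g'(2) in simp)
qed

text \<open>\<open>sum_trapezoid_error\<close> is solved for the partial sum of the Dirichlet-type
  series; for Re s > 1 the boundary terms at x + N tend to 0.\<close>

lemma powr_sums_em_zeta:
  assumes s: "Re s > 1" and x: "x > 0"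
  shows "(\<lambda>n. of_real (x + real n) powr -s) sums (em_zeta s x / (s - 1))"
proof -
  have s1: "s \<noteq> 1" using s by auto
  have lim: "(\<lambda>N. of_real (x + real N) powr w :: complex) \<longlonglongrightarrow> 0" if "Re w < 0" for w
  proof (rule tendsto_norm_zero_cancel)
    have "(\<lambda>N. (x + real N) powr Re w) \<longlonglongrightarrow> 0"
      by (rule tendsto_neg_powr[OF that])
         (intro filterlim_tendsto_add_at_top[OF tendsto_const] filterlim_real_sequentially)
    moreover have "norm (of_real (x + real N) powr w) = (x + real N) powr Re w" for N
      using x by (subst norm_of_real_powr) auto
    ultimately show "(\<lambda>N. norm (of_real (x + real N) powr w)) \<longlonglongrightarrow> 0" by simp
  qed
  have ul: "uniform_limit {(s, x)} (\<lambda>N (s, x). \<Sum>n<N. trapezoid_error s (x + real n)) 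
     (\<lambda>(s, x). \<Sum>n. trapezoid_error s (x + real n)) sequentially"
    by (rule uniform_limit_on_subset[OF uniform_limit_trapezoid_error[of 0 "norm s + 1"]]) (use s x in auto)
  have "(\<lambda>N. \<Sum>n<N. trapezoid_error s (x + real n)) \<longlonglongrightarrow> (\<Sum>n. trapezoid_error s (x + real n))"
    using tendsto_uniform_limitI[OF ul, of "(s, x)"] by simp
  hence "(\<lambda>N. ((\<Sum>n<N. trapezoid_error s (x + real n)) - of_real (x + real N) powr (1 - s) + of_real x powr (1 - s)) / (s - 1) 
          + of_real x powr -s / 2 - of_real (x + real N) powr -s / 2) \<longlonglongrightarrow> 
        ((\<Sum>n. trapezoid_error s (x + real n)) - 0 + of_real x powr (1 - s)) / (s - 1) 
          + of_real x powr -s / 2 - 0 / 2"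
    using s s1 by (intro tendsto_intros lim) auto
  moreover have "((\<Sum>n<N. trapezoid_error s (x + real n)) - of_real (x + real N) powr (1 - s) + of_real x powr (1 - s)) / (s - 1) 
          + of_real x powr -s / 2 - of_real (x + real N) powr -s / 2 = (\<Sum>n<N. of_real (x + real n) powr -s)" for N
    using s1 by (subst sum_trapezoid_error) (simp add: divide_simps, simp add: algebra_simps)
  moreover have "((\<Sum>n. trapezoid_error s (x + real n)) - 0 + of_real x powr (1 - s)) / (s - 1) 
          + of_real x powr -s / 2 - 0 / 2 = em_zeta s x / (s - 1)"
    unfolding em_zeta_def using s1 by (simp add: divide_simps) (simp add: algebra_simps)
  ultimately show ?thesis unfolding sums_def by simp
qed

section \<open>Continuation to the whole plane\<close>

text \<open>The Leibniz rule asks for a jointly continuous derivative in z, while only f is assumed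
  jointly continuous. Cauchy's formula on a circle writes the derivative as an integral of f over
  that circle, and so transfers the continuity.\<close>

lemma holomorphic_on_integral_param:
  fixes f :: "complex \<Rightarrow> real \<Rightarrow> complex"
  assumes op: "open S" and cont: "continuous_on (S \<times> {a..b}) (\<lambda>(z, t). f z t)"
    and hol: "\<And>t. t \<in> {a..b} \<Longrightarrow> (\<lambda>z. f z t) holomorphic_on S"
  shows "(\<lambda>z. integral {a..b} (f z)) holomorphic_on S"
proof -
  have "(\<lambda>z. integral {a..b} (f z)) field_differentiable at z0" if z0: "z0 \<in> S" for z0
  proof -
    obtain r where r: "r > 0" "cball z0 r \<subseteq> S" using op z0 by (meson open_contains_cball)
    define c where "c = circlepath z0 r"
    define F where "F = (\<lambda>z t. 1 / (2 * of_real pi * \<i>) * integral {0..1} (\<lambda>u. f (c u) t / (c u - z) ^ 2 *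
        (2 * of_real pi * \<i> * r * exp (2 * of_real pi * \<i> * u))))"
    have c: "c u \<in> cball z0 r" "dist z0 (c u) = r" for u
      using r by (auto simp: c_def circlepath dist_norm norm_mult)
    have conts: "continuous_on A (\<lambda>x. f (g x) (h x))"
      if "continuous_on A g" "continuous_on A h" "\<And>x. x \<in> A \<Longrightarrow> g x \<in> S \<and> h x \<in> {a..b}" 
      for A :: "'x::topological_space set" and g h
      by (rule continuous_on_compose2[OF cont continuous_on_Pair[OF that(1,2)], simplified]) (use that(3) in force)
    have der: "((\<lambda>z. f z t) has_field_derivative F z t) (at z within ball z0 r)"
      if "z \<in> ball z0 r" "t \<in> cbox a b" for z t
    proof -
      have "((\<lambda>z. f z t) has_field_derivative (1 / (2 * of_real pi * \<i>) * 
              contour_integral (circlepath z0 r) (\<lambda>u. f u t / (u - z)^2))) (at z)"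
      proof (rule Cauchy_derivative_integral_circlepath)
        show "continuous_on (cball z0 r) (\<lambda>z. f z t)"
          using that r by (intro conts continuous_intros) auto
        show "(\<lambda>z. f z t) holomorphic_on ball z0 r"
          by (rule holomorphic_on_subset[OF hol]) (use that r ball_subset_cball[of z0 r] in auto)
      qed fact
      also have "contour_integral (circlepath z0 r) (\<lambda>u. f u t / (u - z)^2) = 
        integral {0..1} (\<lambda>u. f (c u) t / (c u - z) ^ 2 * (2 * of_real pi * \<i> * r * exp (2 * of_real pi * \<i> * u)))"
        unfolding contour_integral_integral c_def by (simp add: vector_derivative_circlepath)
      finally show ?thesis unfolding F_def by (rule has_field_derivative_at_within)
    qed
    have ccont: "continuous_on A (\<lambda>x. c (g x))" if "continuous_on A g" for A :: "'x::topological_space set" and g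
      unfolding c_def circlepath by (intro continuous_intros that)
    have "continuous_on (ball z0 r \<times> {a..b}) (\<lambda>x. F (fst x) (snd x))"
      unfolding F_def
    proof (intro continuous_on_mult_left, fold box_real(2), rule integral_continuous_on_param)
      show "continuous_on ((ball z0 r \<times> cbox a b) \<times> cbox 0 1) (\<lambda>(x, u). f (c u) (snd x) / (c u - fst x)\<^sup>2 *
              (2 * of_real pi * \<i> * r * exp (2 * of_real pi * \<i> * of_real u)))"
        unfolding case_prod_unfold using c r
        by (intro continuous_intros conts ccont) (auto simp: subset_iff dist_norm)
    qed
    hence Fc: "continuous_on (ball z0 r \<times> cbox a b) (\<lambda>(z, t). F z t)" by (simp add: case_prod_unfold)
    have int: "f z integrable_on cbox a b" if "z \<in> ball z0 r" for z
      using that r unfolding box_real by (intro integrable_continuous_real conts continuous_intros) auto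
    have "(\<lambda>z. integral (cbox a b) (f z)) holomorphic_on ball z0 r"
      by (rule leibniz_rule_holomorphic[OF der int Fc]) auto
    thus ?thesis using r by (auto simp: holomorphic_on_open field_differentiable_def)
  qed
  thus ?thesis by (simp add: field_differentiable_at_within holomorphic_onI)
qed

text \<open>
  This comes from Taylor's formula for \<open>t powr (1 - s)\<close>; it expresses the left-hand side
  through the value at \<open>s + 1\<close>, which is what extends the domain by a strip of width \<open>1\<close>.
\<close>
lemma em_zeta_recursion:
  assumes s: "Re s > 1" and x: "x > 0"
  shows "em_zeta s x = of_real x powr (1 - s) + 
           (s - 1) * integral {0..1} (\<lambda>t. of_real (1 - t) * em_zeta (s + 1) (x + t))"
proof -
  \<comment> \<open>\<open>em_zeta (s + 1)\<close> is s times the series at s + 1, hence the factor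
    s in \<open>?f\<close>. Uniform convergence on [0, 1] allows integration term by term.\<close>
  let ?f = "\<lambda>N t. of_real (1 - t) * (s * (\<Sum>n<N. of_real (x + t + real n) powr (-s - 1)))"
  let ?g = "\<lambda>t. of_real (1 - t) * em_zeta (s + 1) (x + t)"
  have s1: "s \<noteq> 1" "s \<noteq> 0" using s by auto
  have "uniform_limit {0..1} (\<lambda>N t. \<Sum>n<N. of_real (x + t + real n) powr (-s - 1))
          (\<lambda>t. \<Sum>n. of_real (x + t + real n) powr (-s - 1)) sequentially"
  proof (rule Weierstrass_m_test_ev)
    show "summable (\<lambda>n. real n powr (- Re s - 1))"
      using s by (simp add: summable_real_powr_iff)
    show "\<forall>\<^sub>F n in sequentially. \<forall>t\<in>{0..1}. 
            norm (of_real (x + t + real n) powr (- s - 1)) \<le> real n powr (- Re s - 1)"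
      using eventually_gt_at_top[of 0]
    proof eventually_elim
      case (elim n)
      show ?case
      proof
        fix t :: real assume "t \<in> {0..1}"
        thus "norm (of_real (x + t + real n) powr (- s - 1)) \<le> real n powr (- Re s - 1)"
          using elim s x by (subst norm_of_real_powr) (auto intro!: powr_mono2')
      qed
    qed
  qed
  moreover have "(\<Sum>n. of_real (x + t + real n) powr (-s - 1)) = em_zeta (s + 1) (x + t) / s" if "t \<in> {0..1}" for t
    using powr_sums_em_zeta[of "s + 1" "x + t"] s x that by (simp add: sums_iff)
  ultimately have "uniform_limit {0..1} (\<lambda>N t. \<Sum>n<N. of_real (x + t + real n) powr (-s - 1))
          (\<lambda>t. em_zeta (s + 1) (x + t) / s) sequentially"
    by (metis (no_types, lifting) uniform_limit_cong')
  hence "uniform_limit {0..1} (\<lambda>N t. s * (\<Sum>n<N. of_real (x + t + real n) powr (-s - 1)))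
          (\<lambda>t. s * (em_zeta (s + 1) (x + t) / s)) sequentially"
    by (rule bounded_linear_uniform_limit_intros)
  hence "uniform_limit {0..1} ?f (\<lambda>t. of_real (1 - t) * (s * (em_zeta (s + 1) (x + t) / s))) sequentially"
  proof (rule uniform_lim_mult[OF uniform_limit_const])
    show "bounded ((\<lambda>t. of_real (1 - t) :: complex) ` {0..1})"
      by (intro compact_imp_bounded compact_continuous_image continuous_intros) auto
    have "continuous_on {0..1} (\<lambda>t. em_zeta (s + 1) (x + t))"
      using s x by (intro continuous_on_compose2[OF continuous_on_em_zeta, of _ "\<lambda>t. (s + 1, x + t)", simplified] continuous_intros) auto
    thus "bounded ((\<lambda>t. s * (em_zeta (s + 1) (x + t) / s)) ` {0..1})"
      by (intro compact_imp_bounded compact_continuous_image continuous_intros) (use s1 in auto)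
  qed
  hence ul: "uniform_limit {0..1} ?f ?g sequentially" using s1 by simp
  have cf: "continuous_on {0..1} (?f N)" for N
  proof -
    have h: "continuous_on {0..1} (\<lambda>t. of_real (x + t + real n) powr (-s - 1) :: complex)" for n
      using x by (intro continuous_on_of_real_powr continuous_intros) auto
    show ?thesis
      by (intro continuous_on_mult continuous_on_sum continuous_on_const h) (intro continuous_intros)
  qed
  obtain I J where I: "\<And>N. (?f N has_integral I N) {0..1}" and J: "(?g has_integral J) {0..1}" and IJ: "I \<longlonglongrightarrow> J"
    using uniform_limit_integral[OF ul cf] by auto
  have piece: "((\<lambda>t. of_real (1 - t) * (s * of_real (y + t) powr (-s - 1))) has_integral
          (of_real y powr -s + (of_real (y + 1) powr (1 - s) - of_real y powr (1 - s)) / (s - 1))) {0..1}" if y: "y > 0" for y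
  proof -
    \<comment> \<open>Integration by parts: the factor t - 1 vanishes at t = 1 and leaves
      \<open>y powr -s\<close> from t = 0; the second summand cancels the extra
      \<open>(y + t) powr -s\<close>.\<close>
    define G where "G = (\<lambda>t. (of_real t - 1) * of_real (y + t) powr -s + of_real (y + t) powr (1 - s) / (s - 1))"
    have "((\<lambda>t. of_real (1 - t) * (s * of_real (y + t) powr (-s - 1))) has_integral (G 1 - G 0)) {0..1}"
    proof (rule fundamental_theorem_of_calculus)
      fix t :: real assume t: "t \<in> {0..1}"
      have yt: "y + t > 0" using y t by auto
      have id: "(of_real has_vector_derivative (1::complex)) (at t within {0..1})"
        by (rule has_vector_derivative_at_within) (use has_vector_derivative_of_real[OF DERIV_ident] in simp)
      have "(G has_vector_derivative (of_real t - 1) * (- s * of_real (y + t) powr (-s - 1)) + (1 - 0) * of_real (y + t) powr -s +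
              ((1 - s) * of_real (y + t) powr (1 - s - 1)) / (s - 1)) (at t within {0..1})"
        unfolding G_def
        by (intro has_vector_derivative_add has_vector_derivative_mult has_vector_derivative_diff id
              has_vector_derivative_of_real_powr[OF yt] has_vector_derivative_const has_vector_derivative_divide)
      also have "(of_real t - 1) * (- s * of_real (y + t) powr (-s - 1)) + (1 - 0) * of_real (y + t) powr -s +
              ((1 - s) * of_real (y + t) powr (1 - s - 1)) / (s - 1) = of_real (1 - t) * (s * of_real (y + t) powr (-s - 1))"
        using s1 by (simp add: field_simps del: of_real_add)
      finally show "(G has_vector_derivative of_real (1 - t) * (s * of_real (y + t) powr (-s - 1))) (at t within {0..1})" .
    qed auto
    thus ?thesis by (simp add: G_def algebra_simps diff_divide_distrib)
  qed
  have I_eq: "I N = (\<Sum>n<N. of_real (x + real n) powr -s) + (of_real (x + real N) powr (1 - s) - of_real x powr (1 - s)) / (s - 1)" for N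
  proof -
    have eq: "?f N = (\<lambda>t. \<Sum>n<N. of_real (1 - t) * (s * of_real ((x + real n) + t) powr (-s - 1)))"
      by (simp add: sum_distrib_left algebra_simps)
    have "(?f N has_integral (\<Sum>n<N. of_real (x + real n) powr -s + 
            (of_real (x + real n + 1) powr (1 - s) - of_real (x + real n) powr (1 - s)) / (s - 1))) {0..1}"
      unfolding eq using x by (intro has_integral_sum piece) auto
    also have "(\<Sum>n<N. of_real (x + real n) powr -s + 
            (of_real (x + real n + 1) powr (1 - s) - of_real (x + real n) powr (1 - s)) / (s - 1)) = 
          (\<Sum>n<N. of_real (x + real n) powr -s) + (\<Sum>n<N. of_real (x + real (Suc n)) powr (1 - s) - of_real (x + real n) powr (1 - s)) / (s - 1)"
      by (simp add: sum.distrib sum_divide_distrib algebra_simps)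
    also have "(\<Sum>n<N. of_real (x + real (Suc n)) powr (1 - s) - of_real (x + real n) powr (1 - s)) = 
        of_real (x + real N) powr (1 - s) - of_real x powr (1 - s)"
      by (subst sum_lessThan_telescope) simp
    finally show ?thesis using has_integral_unique[OF I] by blast
  qed
  have "(\<lambda>N. of_real (x + real N) powr (1 - s)) \<longlonglongrightarrow> 0"
  proof (rule tendsto_norm_zero_cancel)
    have "(\<lambda>N. (x + real N) powr Re (1 - s)) \<longlonglongrightarrow> 0"
      by (rule tendsto_neg_powr) (use s in \<open>auto intro!: filterlim_tendsto_add_at_top[OF tendsto_const] filterlim_real_sequentially\<close>)
    moreover have "norm (of_real (x + real N) powr (1 - s)) = (x + real N) powr Re (1 - s)" for N
      using x by (subst norm_of_real_powr) auto
    ultimately show "(\<lambda>N. norm (of_real (x + real N) powr (1 - s))) \<longlonglongrightarrow> 0" by simp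
  qed
  hence "I \<longlonglongrightarrow> em_zeta s x / (s - 1) + (0 - of_real x powr (1 - s)) / (s - 1)"
    unfolding I_eq using powr_sums_em_zeta[OF s x] s1 unfolding sums_def by (intro tendsto_intros) auto
  hence "J = em_zeta s x / (s - 1) + (0 - of_real x powr (1 - s)) / (s - 1)"
    using IJ LIMSEQ_unique by blast
  moreover have "integral {0..1} ?g = J" using J by (rule integral_unique)
  moreover have "(s - 1) * (em_zeta s x / (s - 1) + (0 - of_real x powr (1 - s)) / (s - 1)) = 
                   em_zeta s x - of_real x powr (1 - s)"
    using s1 by (simp add: right_diff_distrib)
  ultimately show ?thesis by simp
qed

text \<open>The recursion serves as the definition of the next extension. Joint continuity is
  carried through the induction because the step integrates F over x + t; agreement with
  \<open>em_zeta\<close> is kept on Re s > 1, where the recursion was proved.\<close>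

lemma em_zeta_extension:
  "\<exists>F. continuous_on ({s. Re s > -1 - real k} \<times> {0<..}) (\<lambda>(s, x). F s x) \<and>
       (\<forall>x>0. (\<lambda>s. F s x) holomorphic_on {s. Re s > -1 - real k}) \<and>
       (\<forall>x>0. \<forall>s. Re s > 1 \<longrightarrow> F s x = em_zeta s x)"
proof (induction k)
  case 0
  have "(\<lambda>s. em_zeta s x) holomorphic_on {s. Re s > -1}" if x: "x > 0" for x
  proof -
    obtain D where "\<And>s. Re s > -1 \<Longrightarrow> ((\<lambda>s. em_zeta s x) has_field_derivative D s) (at s)"
      using em_zeta_has_field_derivative[OF x] by metis
    thus ?thesis
      by (auto simp: holomorphic_on_def field_differentiable_def intro: has_field_derivative_at_within)
  qed
  thus ?case using continuous_on_em_zeta by (intro exI[of _ em_zeta]) auto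
next
  case (Suc k)
  then obtain F where F: "continuous_on ({s. Re s > -1 - real k} \<times> {0<..}) (\<lambda>(s, x). F s x)"
    "\<And>x. x > 0 \<Longrightarrow> (\<lambda>s. F s x) holomorphic_on {s. Re s > -1 - real k}"
    "\<And>x s. x > 0 \<Longrightarrow> Re s > 1 \<Longrightarrow> F s x = em_zeta s x" by blast
  define S where "S = {s::complex. Re s > -1 - real (Suc k)}"
  have Fc: "continuous_on A (\<lambda>x. F (g x) (h x))"
      if "continuous_on A g" "continuous_on A h" "\<And>x. x \<in> A \<Longrightarrow> Re (g x) > -1 - real k \<and> h x > 0" 
      for A :: "'x::topological_space set" and g h
    by (rule continuous_on_compose2[OF F(1) continuous_on_Pair[OF that(1,2)], simplified]) (use that(3) in force)
  define I where "I = (\<lambda>s x. integral {0..1} (\<lambda>t. of_real (1 - t) * F (s + 1) (x + t)))"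
  define G where "G = (\<lambda>s x. of_real x powr (1 - s) + (s - 1) * I s x)"
  have "continuous_on (S \<times> {0<..}) (\<lambda>z. I (fst z) (snd z))"
    unfolding I_def
  proof (fold box_real(2), rule integral_continuous_on_param)
    show "continuous_on ((S \<times> {0<..}) \<times> cbox 0 1) (\<lambda>(z, t). of_real (1 - t) * F (fst z + 1) (snd z + t))"
      unfolding case_prod_unfold by (intro continuous_intros Fc) (auto simp: S_def)
  qed
  hence 1: "continuous_on (S \<times> {0<..}) (\<lambda>(s, x). G s x)"
    unfolding G_def case_prod_unfold
    by (intro continuous_intros) (auto simp: S_def complex_nonpos_Reals_iff)
  have 2: "(\<lambda>s. G s x) holomorphic_on S" if x: "x > 0" for x
  proof -
    have "(\<lambda>s. I s x) holomorphic_on S"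
      unfolding I_def
    proof (rule holomorphic_on_integral_param)
      show "open S" unfolding S_def by (intro open_Collect_less continuous_intros)
      show "continuous_on (S \<times> {0..1}) (\<lambda>(s, t). of_real (1 - t) * F (s + 1) (x + t))"
        unfolding case_prod_unfold using x by (intro continuous_intros Fc) (auto simp: S_def)
      fix t :: real assume t: "t \<in> {0..1}"
      have "((\<lambda>s. F s (x + t)) \<circ> (\<lambda>s. s + 1)) holomorphic_on S"
        by (rule holomorphic_on_compose_gen[OF _ F(2)]) (use x t in \<open>auto intro!: holomorphic_intros simp: S_def\<close>)
      thus "(\<lambda>s. of_real (1 - t) * F (s + 1) (x + t)) holomorphic_on S"
        by (intro holomorphic_intros) (simp add: o_def)
    qed
    thus ?thesis unfolding G_def by (intro holomorphic_intros)
  qed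
  have 3: "G s x = em_zeta s x" if "x > 0" "Re s > 1" for x s
  proof -
    have "I s x = integral {0..1} (\<lambda>t. of_real (1 - t) * em_zeta (s + 1) (x + t))"
      unfolding I_def using that by (intro integral_cong) (auto simp: F(3))
    thus ?thesis using em_zeta_recursion[of s x] that by (simp add: G_def)
  qed
  from 1 2 3 show ?case unfolding S_def by (intro exI[of _ G]) auto
qed

text \<open>The identity theorem makes the extensions to the half-planes compatible.\<close>
lemma em_zeta_entire_extension:
  assumes x: "x > 0"
  obtains F where "F holomorphic_on UNIV" "\<And>s. Re s > -1 \<Longrightarrow> F s = em_zeta s x"
proof -
  define S where "S = (\<lambda>k. {s::complex. Re s > -1 - real k})"
  have "\<forall>k. \<exists>f. f holomorphic_on S k \<and> (\<forall>s. Re s > 1 \<longrightarrow> f s = em_zeta s x)"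
    using em_zeta_extension x unfolding S_def by meson
  then obtain f where f: "\<And>k. f k holomorphic_on S k" "\<And>k s. Re s > 1 \<Longrightarrow> f k s = em_zeta s x" by metis
  have op: "open (S k)" for k unfolding S_def by (intro open_Collect_less continuous_intros)
  have conn: "connected (S k)" for k
    unfolding S_def using convex_halfspace_Re_gt by (intro convex_connected)
  have U: "open {s::complex. Re s > 1}" by (intro open_Collect_less continuous_intros)
  have ne: "{s::complex. Re s > 1} \<noteq> {}" by (auto intro!: exI[of _ 2])
  have unique: "f j s = f k s" if "j \<le> k" "s \<in> S j" for j k s
  proof (rule analytic_continuation_open[OF U op ne conn, of "j" "f j" "f k"])
    show "f k holomorphic_on S j" 
      by (rule holomorphic_on_subset[OF f(1)]) (use that in \<open>auto simp: S_def\<close>)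
  qed (use f that in \<open>auto simp: S_def\<close>)
  \<comment> \<open>With k the ceiling of - Re s one has Re s >= -k > -1 - k, so each point lies in
    the domain of the extension chosen for it.\<close>
  define F where "F = (\<lambda>s. f (nat \<lceil>- Re s\<rceil>) s)"
  have in_S: "s \<in> S (nat \<lceil>- Re s\<rceil>)" for s
    unfolding S_def using real_nat_ceiling_ge[of "- Re s"] by (auto simp: algebra_simps)
  have F_eq: "F s = f k s" if "s \<in> S k" for k s
    unfolding F_def using unique that in_S[of s] by (metis le_cases)
  show ?thesis
  proof
    have "F field_differentiable at s" for s
    proof -
      define k where "k = nat \<lceil>- Re s\<rceil>"
      have "f k field_differentiable at s"
        using f(1)[of k] in_S[of s] op[of k] by (auto simp: k_def intro: holomorphic_on_imp_differentiable_at)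
      thus ?thesis
        unfolding field_differentiable_def
        using in_S[of s] F_eq[of _ k] op[of k] unfolding k_def[symmetric]
        by (metis has_field_derivative_transform_within_open)
    qed
    thus "F holomorphic_on UNIV" by (simp add: holomorphic_on_def field_differentiable_at_within)
    obtain D where D: "\<And>s. Re s > -1 \<Longrightarrow> ((\<lambda>s. em_zeta s x) has_field_derivative D s) (at s)"
      using em_zeta_has_field_derivative[OF x] by metis
    have hol: "(\<lambda>s. em_zeta s x) holomorphic_on S 0"
      using D by (auto simp: S_def holomorphic_on_def field_differentiable_def intro: has_field_derivative_at_within)
    fix s :: complex assume s: "Re s > -1"
    have "f 0 s = em_zeta s x"
      by (rule analytic_continuation_open[OF U op ne conn, of 0 "f 0"])
         (use f(1)[of 0] f(2) s hol in \<open>auto simp: S_def\<close>)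
    thus "F s = em_zeta s x" using F_eq[of s 0] s by (simp add: S_def)
  qed
qed

section \<open>The series for \<open>hurwitz_zeta\<close>, its derivative at 0 and the values at
  integers\<close>

lemma has_field_derivative_of_real_powr_right:
  fixes c s :: complex
  assumes "y > 0"
  shows "((\<lambda>s. of_real y powr (c - s)) has_field_derivative - of_real (ln y) * of_real y powr (c - s)) (at s)"
proof -
  have "((\<lambda>z. of_real y powr z) has_field_derivative Ln (of_real y) * of_real y powr (c - s)) (at (c - s))"
    using assms by (intro has_field_derivative_powr_right) auto
  moreover have "((\<lambda>s. c - s) has_field_derivative -1) (at s)" by (auto intro!: derivative_eq_intros)
  ultimately have "((\<lambda>s. of_real y powr (c - s)) has_field_derivative Ln (of_real y) * of_real y powr (c - s) * -1) (at s)"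
    by (rule DERIV_chain2)
  thus ?thesis using assms by (simp add: Ln_of_real)
qed

text \<open>The entire extension divided by s - 1 witnesses existence in the definite description.
  Uniqueness is the identity theorem, the punctured plane being connected.\<close>

lemma
  assumes x: "x > 0"
  shows hurwitz_zeta_eq_em_zeta: "Re s > -1 \<Longrightarrow> s \<noteq> 1 \<Longrightarrow> hurwitz_zeta x s = em_zeta s x / (s - 1)"
    and hurwitz_zeta_sums: "Re s > 1 \<Longrightarrow> (\<lambda>n. of_real (x + real n) powr -s) sums hurwitz_zeta x s"
proof -
  let ?P = "\<lambda>f::complex \<Rightarrow> complex. f holomorphic_on - {1} \<and>
     (\<forall>s. Re s > 1 \<longrightarrow> f s = (\<Sum>n. (of_nat n + of_real x) powr - s)) \<and> f 1 = 0"
  obtain F where F: "F holomorphic_on UNIV" "\<And>s. Re s > -1 \<Longrightarrow> F s = em_zeta s x"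
    using em_zeta_entire_extension[OF x] by blast
  \<comment> \<open>Division by zero gives \<open>f 1 = 0\<close>, which is exactly the value
    prescribed at the pole.\<close>
  define f where "f = (\<lambda>s. F s / (s - 1))"
  have sums: "(\<lambda>n. of_real (x + real n) powr -s) sums f s" if "Re s > 1" for s
    using powr_sums_em_zeta[OF that x] F(2)[of s] that by (simp add: f_def)
  have Pf: "?P f"
  proof (intro conjI allI impI)
    show "f holomorphic_on - {1}"
      unfolding f_def by (intro holomorphic_intros holomorphic_on_subset[OF F(1)]) auto
    show "f s = (\<Sum>n. (of_nat n + of_real x) powr - s)" if "Re s > 1" for s
      using sums[OF that] by (simp add: sums_iff add_ac)
  qed (simp add: f_def)
  have "g = f" if Pg: "?P g" for g
  proof
    fix s
    show "g s = f s"
    proof (cases "s = 1")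
      case False
      show ?thesis
      proof (rule analytic_continuation_open[of "{s. Re s > 1}" "- {1}" g f])
        show "open {s::complex. Re s > 1}" by (intro open_Collect_less continuous_intros)
        show "{s::complex. Re s > 1} \<noteq> {}" by (auto intro!: exI[of _ 2])
        show "connected (- {1::complex})" by (intro connected_punctured_universe) simp
      qed (use Pf Pg False in auto)
    qed (use Pf Pg in auto)
  qed
  hence eq: "hurwitz_zeta x = f"
    unfolding hurwitz_zeta_def using Pf by (intro the_equality)
  show "Re s > -1 \<Longrightarrow> s \<noteq> 1 \<Longrightarrow> hurwitz_zeta x s = em_zeta s x / (s - 1)"
    by (simp add: eq f_def F(2))
  show "Re s > 1 \<Longrightarrow> (\<lambda>n. of_real (x + real n) powr -s) sums hurwitz_zeta x s"
    unfolding eq by (rule sums)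
qed

text \<open>This is the integral of ln over [y, y + 1] minus its trapezoidal approximation; summed
  over y = x + n it is Gudermann's series for the remainder in Stirling's formula.\<close>

definition stirling_term :: "real \<Rightarrow> real" where
  "stirling_term y = (y + 1 / 2) * (ln (y + 1) - ln y) - 1"

text \<open>The quotient rule for \<open>em_zeta s x / (s - 1)\<close> at 0 gives minus the
  derivative minus the value of \<open>em_zeta\<close> there. Differentiating its series term by
  term produces the Stirling terms, and their summability along with them.\<close>

lemma
  assumes x: "x > 0"
  shows summable_stirling_term: "summable (\<lambda>n. stirling_term (x + real n))"
    and deriv_hurwitz_zeta_0_series: "deriv (hurwitz_zeta x) 0 = of_real (x * ln x - x - ln x / 2 + (\<Sum>n. stirling_term (x + real n)))"
proof -
  note powr_der = has_field_derivative_of_real_powr_right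
  note powr_der' = powr_der[where c = 0, simplified]
  have T: "deriv (\<lambda>s. trapezoid_error s y) 0 = - of_real (stirling_term y)" if y: "y > 0" for y
  proof (rule DERIV_imp_deriv)
    have y1: "y + 1 > 0" using y by simp
    have "((\<lambda>s. trapezoid_error s y) has_field_derivative
        (0 - 1) / 2 * (- of_real (ln y) * of_real y powr - 0 + - of_real (ln (y + 1)) * of_real (y + 1) powr - 0) +
        (1 - 0) / 2 * (of_real y powr - 0 + of_real (y + 1) powr - 0) +
        - of_real (ln (y + 1)) * of_real (y + 1) powr (1 - 0) - 
        (- of_real (ln y) * of_real y powr (1 - 0))) (at 0)"
      unfolding trapezoid_error_def
      by (rule derivative_eq_intros powr_der[OF y] powr_der[OF y1] powr_der'[OF y] powr_der'[OF y1] refl | simp)+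
    also have "(0 - 1) / 2 * (- of_real (ln y) * of_real y powr - 0 + - of_real (ln (y + 1)) * of_real (y + 1) powr - 0) +
        (1 - 0) / 2 * (of_real y powr - 0 + of_real (y + 1) powr - 0) +
        - of_real (ln (y + 1)) * of_real (y + 1) powr (1 - 0) - 
        (- of_real (ln y) * of_real y powr (1 - 0)) = (- of_real (stirling_term y) :: complex)"
    proof -
      have [simp]: "of_real y powr 0 = (1::complex)" "of_real (y + 1) powr 0 = (1::complex)"
        "of_real y powr 1 = (of_real y::complex)" "of_real (y + 1) powr 1 = (of_real (y + 1)::complex)"
        using y y1 by (simp_all add: powr_def Ln_of_real exp_of_real del: of_real_add)
      show ?thesis
        using y y1 by (simp add: stirling_term_def del: of_real_add) (simp add: field_simps)
    qed
    finally show "((\<lambda>s. trapezoid_error s y) has_field_derivative - of_real (stirling_term y)) (at 0)" .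
  qed
  let ?h = "\<lambda>s::complex. of_real x powr (1 - s) + (s - 1) / 2 * of_real x powr -s"
  have h: "deriv ?h 0 = - of_real (x * ln x) + 1 / 2 + of_real (ln x) / 2"
  proof (rule DERIV_imp_deriv)
    have "(?h has_field_derivative - of_real (ln x) * of_real x powr (1 - 0) + 
            ((0 - 1) / 2 * (- of_real (ln x) * of_real x powr - 0) + (1 - 0) / 2 * of_real x powr - 0)) (at 0)"
      by (rule derivative_eq_intros powr_der[OF x] powr_der'[OF x] refl | simp)+
    thus "(?h has_field_derivative - of_real (x * ln x) + 1 / 2 + of_real (ln x) / 2) (at 0)"
      using x by (simp add: algebra_simps)
  qed
  obtain D where D: "\<And>s. Re s > -1 \<Longrightarrow> ((\<lambda>s. em_zeta s x) has_field_derivative D s) (at s)"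
    "\<And>s. Re s > -1 \<Longrightarrow> (\<lambda>n. deriv (\<lambda>s. trapezoid_error s (x + real n)) s) sums (D s - deriv ?h s)"
    using that by (rule em_zeta_has_field_derivative[OF x])
  have "(\<lambda>n. - of_real (stirling_term (x + real n))) sums (D 0 - deriv ?h 0)"
    using D(2)[of 0] x by (simp add: T)
  from sums_minus[OF this] have sums: "(\<lambda>n. of_real (stirling_term (x + real n))) sums (deriv ?h 0 - D 0)"
    by simp
  thus summable: "summable (\<lambda>n. stirling_term (x + real n))"
    using sums_Re[OF sums] by (simp add: sums_iff)
  have sum: "of_real (\<Sum>n. stirling_term (x + real n)) = deriv ?h 0 - D 0"
    using sums_unique2[OF sums_of_real[OF summable_sums[OF summable]] sums] by simp
  \<comment> \<open>At s = 0 the integrand is constant and the trapezoidal rule is exact.\<close>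
  have "trapezoid_error 0 y = 0" if "y > 0" for y
    using that by (simp add: trapezoid_error_def powr_def Ln_of_real exp_of_real del: of_real_add) simp
  hence em0: "em_zeta 0 x = of_real x - 1 / 2"
    using x by (simp add: em_zeta_def)
  have "((\<lambda>s. em_zeta s x / (s - 1)) has_field_derivative (D 0 * (0 - 1) - em_zeta 0 x * (1 - 0)) / ((0 - 1) * (0 - 1))) (at 0)"
    by (intro DERIV_divide D(1) DERIV_diff DERIV_ident DERIV_const) auto
  hence "(hurwitz_zeta x has_field_derivative (D 0 * (0 - 1) - em_zeta 0 x * (1 - 0)) / ((0 - 1) * (0 - 1))) (at 0)"
  proof (rule has_field_derivative_transform_within_open)
    show "open (ball (0::complex) 1)" "0 \<in> ball (0::complex) 1" by auto
    fix s :: complex assume "s \<in> ball 0 1"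
    hence "norm s < 1" by (simp add: dist_norm)
    hence "Re s > -1" "s \<noteq> 1" using abs_Re_le_cmod[of s] by auto
    thus "em_zeta s x / (s - 1) = hurwitz_zeta x s" using hurwitz_zeta_eq_em_zeta[OF x] by simp
  qed
  hence "deriv (hurwitz_zeta x) 0 = - D 0 - em_zeta 0 x" by (intro DERIV_imp_deriv) simp
  also have "\<dots> = of_real (x * ln x - x - ln x / 2 + (\<Sum>n. stirling_term (x + real n)))"
  proof -
    have "D 0 = - of_real (x * ln x) + 1 / 2 + of_real (ln x) / 2 - of_real (\<Sum>n. stirling_term (x + real n))"
      unfolding sum h by simp
    thus ?thesis unfolding em0 by simp
  qed
  finally show "deriv (hurwitz_zeta x) 0 = of_real (x * ln x - x - ln x / 2 + (\<Sum>n. stirling_term (x + real n)))" .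
qed

lemma zeta_of_nat_sums:
  assumes "m \<ge> 2"
  shows "(\<lambda>n. 1 / of_nat (Suc n) ^ m) sums zeta (of_nat m)"
proof -
  have "(of_real (1 + real n) :: complex) powr - of_nat m = 1 / of_nat (Suc n) ^ m" for n
    using assms by (subst powr_minus, subst powr_nat') (auto simp: divide_inverse)
  thus ?thesis
    using hurwitz_zeta_sums[of 1 "of_nat m"] assms unfolding zeta_def by (simp del: of_real_add)
qed

lemma deriv_zeta_of_nat_sums:
  assumes m: "m \<ge> 2"
  shows "(\<lambda>n. - of_real (ln (Suc n)) / of_nat (Suc n) ^ m) sums deriv zeta (of_nat m)"
proof -
  \<comment> \<open>An abscissa strictly between 1 and 2 gives a uniform majorant and still leaves
    every m >= 2 inside the half-plane.\<close>
  let ?S = "{s::complex. Re s > 3 / 2}"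
  let ?f = "\<lambda>n s. (of_real (1 + real n) :: complex) powr -s"
  let ?f' = "\<lambda>n s. - of_real (ln (1 + real n)) * (of_real (1 + real n) :: complex) powr -s"
  have op: "open ?S" by (intro open_Collect_less continuous_intros)
  have "summable (\<lambda>n. (1 + real n) powr (-3/2))"
    using summable_Suc_iff[of "\<lambda>n. real n powr (-3/2)"] by (simp add: summable_real_powr_iff add_ac)
  moreover have "(?f n has_field_derivative ?f' n s) (at s)" for n s
    using has_field_derivative_of_real_powr_right[of "1 + real n" 0 s] by simp
  moreover have "\<forall>\<^sub>F n in sequentially. \<forall>s\<in>?S. norm (?f n s) \<le> (1 + real n) powr (-3/2)"
    by (intro always_eventually allI ballI, subst norm_of_real_powr) (auto intro!: powr_mono)
  ultimately obtain g g' where g: "\<forall>s\<in>?S. (\<lambda>n. ?f n s) sums g s \<and> (\<lambda>n. ?f' n s) sums g' s \<and> 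
      (g has_field_derivative g' s) (at s)"
    using series_and_derivative_comparison[OF op, of "\<lambda>n. (1 + real n) powr (-3/2)" ?f ?f'] by blast
  have eq: "g s = zeta s" if "s \<in> ?S" for s
  proof -
    have "(\<lambda>n. ?f n s) sums zeta s" using hurwitz_zeta_sums[of 1 s] that by (simp add: zeta_def)
    thus ?thesis using g that sums_unique2 by blast
  qed
  have mS: "of_nat m \<in> ?S" using m by simp
  have "(g has_field_derivative g' (of_nat m)) (at (of_nat m))" using g mS by blast
  hence "(zeta has_field_derivative g' (of_nat m)) (at (of_nat m))"
    using op mS eq by (rule has_field_derivative_transform_within_open)
  hence "deriv zeta (of_nat m) = g' (of_nat m)" by (rule DERIV_imp_deriv)
  moreover have "(\<lambda>n. ?f' n (of_nat m)) sums g' (of_nat m)" using g mS by blast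
  moreover have "?f' n (of_nat m) = - of_real (ln (Suc n)) / of_nat (Suc n) ^ m" for n
    using assms by (subst powr_minus, subst powr_nat') (auto simp: divide_inverse)
  ultimately show ?thesis by simp
qed

section \<open>Binet's formula\<close>

text \<open>
  \<open>stirling_kernel t / (1 - exp (- t))\<close> is the kernel
  \<open>(1 / (exp t - 1) - 1 / t + 1 / 2) / t\<close> of Binet's second formula.
\<close>
definition stirling_kernel :: "real \<Rightarrow> real" where
  "stirling_kernel t = (1 + exp (- t)) / (2 * t) - (1 - exp (- t)) / t\<^sup>2"

text \<open>\<open>v * (1 - v) / 2\<close> is the Peano kernel of the trapezoidal rule on [0, 1]: t
  times \<open>stirling_kernel t\<close> is the error of the rule for exp (- v t). At t = 0 division
  by zero gives \<open>stirling_kernel 0 = 0\<close>, in agreement with the factor t of the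
  integrand.\<close>

lemma nn_integral_stirling_kernel:
  assumes t: "t \<ge> 0"
  shows "(\<integral>\<^sup>+v. ennreal (t * v * (1 - v) / 2 * exp (- (v * t))) * indicator {0..1} v \<partial>lborel) = 
           ennreal (stirling_kernel t)"
proof (cases "t = 0")
  case True
  thus ?thesis by (simp add: stirling_kernel_def)
next
  case False
  hence t: "t > 0" using t by simp
  define F where "F = (\<lambda>v. exp (- (v * t)) * (v\<^sup>2 / 2 + (1 / t - 1 / 2) * v + (1 / t\<^sup>2 - 1 / (2 * t))))"
  have "(\<integral>\<^sup>+v. ennreal (t * v * (1 - v) / 2 * exp (- (v * t))) * indicator {0..1} v \<partial>lborel) = ennreal (F 1 - F 0)"
  proof (rule nn_integral_FTC_Icc[where F = F])
    fix v :: real assume "v \<in> {0..1}"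
    hence v: "0 \<le> v" "v \<le> 1" by auto
    show "(F has_real_derivative t * v * (1 - v) / 2 * exp (- (v * t))) (at v)"
      unfolding F_def using t
      by (auto intro!: derivative_eq_intros simp: field_simps power2_eq_square)
    show "0 \<le> t * v * (1 - v) / 2 * exp (- (v * t))" using v t by simp
  qed auto
  also have "F 1 - F 0 = stirling_kernel t"
    using t by (simp add: F_def stirling_kernel_def field_simps power2_eq_square)
  finally show ?thesis .
qed

lemma nn_integral_t_exp:
  fixes z :: real
  assumes z: "z > 0"
  shows "(\<integral>\<^sup>+t. ennreal (t * exp (- (z * t))) * indicator {0..} t \<partial>lborel) = ennreal (1 / z\<^sup>2)"
proof -
  define F where "F = (\<lambda>t. - exp (- (z * t)) * (t / z + 1 / z\<^sup>2))"
  have "(\<integral>\<^sup>+t. ennreal (t * exp (- (z * t))) * indicator {0..} t \<partial>lborel) = ennreal (0 - F 0)"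
  proof (rule nn_integral_FTC_atLeast[where F = F])
    show "(F has_real_derivative t * exp (- (z * t))) (at t)" if "t \<ge> 0" for t
      unfolding F_def using z by (auto intro!: derivative_eq_intros simp: field_simps power2_eq_square)
    show "(F \<longlongrightarrow> 0) at_top" unfolding F_def using z by real_asymp
  qed auto
  thus ?thesis by (simp add: F_def)
qed

lemma nn_integral_exp_neg:
  fixes z :: real
  assumes z: "z > 0"
  shows "(\<integral>\<^sup>+t. ennreal (exp (- (z * t))) * indicator {0..} t \<partial>lborel) = ennreal (1 / z)"
proof -
  define F where "F = (\<lambda>t. - exp (- (z * t)) / z)"
  have "(\<integral>\<^sup>+t. ennreal (exp (- (z * t))) * indicator {0..} t \<partial>lborel) = ennreal (0 - F 0)"
  proof (rule nn_integral_FTC_atLeast[where F = F])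
    show "(F has_real_derivative exp (- (z * t))) (at t)" if "t \<ge> 0" for t
      unfolding F_def using z by (auto intro!: derivative_eq_intros simp: field_simps power2_eq_square)
    show "(F \<longlongrightarrow> 0) at_top" unfolding F_def using z by real_asymp
  qed auto
  thus ?thesis by (simp add: F_def)
qed

text \<open>Equivalent to tanh (t/2) <= t/2; the function \<open>f\<close> below is increasing
  because 1 + t <= exp t.\<close>

lemma stirling_kernel_nonneg: 
  assumes t: "t \<ge> 0"
  shows "stirling_kernel t \<ge> 0"
proof (cases "t = 0")
  case False
  hence t: "t > 0" using t by simp
  define f where "f = (\<lambda>t::real. t * (1 + exp (- t)) - 2 * (1 - exp (- t)))"
  have "f 0 \<le> f t"
  proof (rule DERIV_nonneg_imp_nondecreasing[where f = f])
    fix x :: real assume x: "0 \<le> x" "x \<le> t"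
    have "(f has_real_derivative (1 + exp (-x)) + x * (- exp (-x)) - 2 * exp (-x)) (at x)"
      unfolding f_def by (auto intro!: derivative_eq_intros)
    moreover have "(1 + exp (-x)) + x * (- exp (-x)) - 2 * exp (-x) \<ge> 0"
    proof -
      have "1 + x \<le> exp x" by (rule exp_ge_add_one_self)
      hence "exp (-x) * (1 + x) \<le> exp (-x) * exp x" by (intro mult_left_mono) auto
      thus ?thesis by (simp add: exp_minus algebra_simps)
    qed
    ultimately show "\<exists>y. (f has_real_derivative y) (at x) \<and> 0 \<le> y" by blast
  qed (use t in auto)
  moreover have "stirling_kernel t = f t / (2 * t\<^sup>2)"
    using t by (simp add: stirling_kernel_def f_def field_simps power2_eq_square)
  ultimately show ?thesis by (simp add: f_def)
qed (simp add: stirling_kernel_def)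

lemma stirling_kernel_measurable [measurable]: "stirling_kernel \<in> borel_measurable borel"
  unfolding stirling_kernel_def by measurable

lemma stirling_term_measurable [measurable]: "stirling_term \<in> borel_measurable borel"
  unfolding stirling_term_def by measurable

text \<open>Tonelli for \<open>t * v * (1 - v) / 2 * exp (- ((y + v) * t))\<close>: integrating over
  v first gives the kernel, integrating over t first gives
  \<open>v * (1 - v) / 2 / (y + v)\<^sup>2\<close>, whose integral over [0, 1] is the Peano form of
  the trapezoidal error for ln.\<close>

lemma stirling_term_conv_nn_integral:
  assumes y: "y > 0"
  shows "(\<integral>\<^sup>+t. ennreal (stirling_kernel t * exp (- (y * t))) * indicator {0..} t \<partial>lborel) = 
           ennreal (stirling_term y)"
    and "stirling_term y \<ge> 0"
proof -
  \<comment> \<open>From the decomposition of v (1 - v) / (y + v)^2 as (1 + 2 y) / (y + v) - 1 - y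
    (1 + y) / (y + v)^2.\<close>
  define F where "F = (\<lambda>v. ((1 + 2 * y) * ln (y + v) - (y + v) + y * (1 + y) / (y + v)) / 2)"
  have "F 0 \<le> F 1 \<and> 
        (\<integral>\<^sup>+v. ennreal (v * (1 - v) / 2 / (y + v)\<^sup>2) * indicator {0..1} v \<partial>lborel) = ennreal (F 1 - F 0)"
  proof (intro conjI)
    have D: "(F has_real_derivative v * (1 - v) / 2 / (y + v)\<^sup>2) (at v)" "0 \<le> v * (1 - v) / 2 / (y + v)\<^sup>2"
      if v: "0 \<le> v" "v \<le> 1" for v
    proof -
      have yv: "y + v > 0" using y v by simp
      have "(F has_real_derivative ((1 + 2 * y) / (y + v) - 1 - y * (1 + y) / (y + v)\<^sup>2) / 2) (at v)"
        unfolding F_def using yv by (auto intro!: derivative_eq_intros simp: power2_eq_square)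
      also have "((1 + 2 * y) / (y + v) - 1 - y * (1 + y) / (y + v)\<^sup>2) / 2 = v * (1 - v) / 2 / (y + v)\<^sup>2"
        using yv by (simp add: divide_simps) (simp add: power2_eq_square algebra_simps)
      finally show "(F has_real_derivative v * (1 - v) / 2 / (y + v)\<^sup>2) (at v)" .
      show "0 \<le> v * (1 - v) / 2 / (y + v)\<^sup>2" using v by simp
    qed
    show "F 0 \<le> F 1"
    proof (rule DERIV_nonneg_imp_nondecreasing[where f = F])
      fix v :: real assume "0 \<le> v" "v \<le> 1"
      thus "\<exists>d. (F has_real_derivative d) (at v) \<and> 0 \<le> d" using D[of v] by blast
    qed simp
    show "(\<integral>\<^sup>+v. ennreal (v * (1 - v) / 2 / (y + v)\<^sup>2) * indicator {0..1} v \<partial>lborel) = ennreal (F 1 - F 0)"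
    proof (rule nn_integral_FTC_Icc[where F = F])
      fix v :: real assume "v \<in> {0..1}"
      hence v: "0 \<le> v" "v \<le> 1" by auto
      show "(F has_real_derivative v * (1 - v) / 2 / (y + v)\<^sup>2) (at v)" "0 \<le> v * (1 - v) / 2 / (y + v)\<^sup>2"
        using D[OF v] by auto
    qed auto
  qed
  moreover have "F 1 - F 0 = stirling_term y"
  proof -
    have "y * (1 + y) / (y + 1) = y" "y * (1 + y) / (y + 0) = 1 + y" using y by (simp_all add: field_simps)
    thus ?thesis unfolding F_def stirling_term_def by (simp add: field_simps)
  qed
  ultimately have v: "(\<integral>\<^sup>+v. ennreal (v * (1 - v) / 2 / (y + v)\<^sup>2) * indicator {0..1} v \<partial>lborel) = 
      ennreal (stirling_term y)" "stirling_term y \<ge> 0" by auto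
  show "stirling_term y \<ge> 0" by fact
  have "(\<integral>\<^sup>+t. ennreal (stirling_kernel t * exp (- (y * t))) * indicator {0..} t \<partial>lborel) = 
        (\<integral>\<^sup>+t. (\<integral>\<^sup>+v. ennreal (t * v * (1 - v) / 2 * exp (- ((y + v) * t))) * 
           indicator {0..1} v * indicator {0..} t \<partial>lborel) \<partial>lborel)"
  proof (rule nn_integral_cong)
    fix t :: real
    show "ennreal (stirling_kernel t * exp (- (y * t))) * indicator {0..} t = 
       (\<integral>\<^sup>+v. ennreal (t * v * (1 - v) / 2 * exp (- ((y + v) * t))) * 
           indicator {0..1} v * indicator {0..} t \<partial>lborel)"
    proof (cases "t \<ge> 0")
      case True
      have "ennreal (stirling_kernel t * exp (- (y * t))) * indicator {0..} t = 
              ennreal (exp (- (y * t))) * ennreal (stirling_kernel t)"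
        using True stirling_kernel_nonneg[OF True] by (simp add: ennreal_mult mult.commute)
      also have "\<dots> = (\<integral>\<^sup>+v. ennreal (exp (- (y * t))) * 
          (ennreal (t * v * (1 - v) / 2 * exp (- (v * t))) * indicator {0..1} v) \<partial>lborel)"
        unfolding nn_integral_stirling_kernel[OF True, symmetric] by (rule nn_integral_cmult[symmetric]) auto
      also have "\<dots> = (\<integral>\<^sup>+v. ennreal (t * v * (1 - v) / 2 * exp (- ((y + v) * t))) * 
           indicator {0..1} v * indicator {0..} t \<partial>lborel)"
        using True by (intro nn_integral_cong) 
          (auto simp: indicator_def ennreal_mult'[symmetric] mult_exp_exp algebra_simps)
      finally show ?thesis .
    qed auto
  qed
  also have "\<dots> = (\<integral>\<^sup>+v. (\<integral>\<^sup>+t. ennreal (t * v * (1 - v) / 2 * exp (- ((y + v) * t))) * 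
           indicator {0..1} v * indicator {0..} t \<partial>lborel) \<partial>lborel)"
    by (rule lborel_pair.Fubini') measurable
  also have "\<dots> = (\<integral>\<^sup>+v. ennreal (v * (1 - v) / 2 / (y + v)\<^sup>2) * indicator {0..1} v \<partial>lborel)"
  proof (rule nn_integral_cong)
    fix v :: real
    show "(\<integral>\<^sup>+t. ennreal (t * v * (1 - v) / 2 * exp (- ((y + v) * t))) * 
           indicator {0..1} v * indicator {0..} t \<partial>lborel) = 
          ennreal (v * (1 - v) / 2 / (y + v)\<^sup>2) * indicator {0..1} v"
    proof (cases "v \<in> {0..1}")
      case True
      hence v: "v * (1 - v) / 2 \<ge> 0" by auto
      have "(\<integral>\<^sup>+t. ennreal (t * v * (1 - v) / 2 * exp (- ((y + v) * t))) * 
           indicator {0..1} v * indicator {0..} t \<partial>lborel) = 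
            (\<integral>\<^sup>+t. ennreal (v * (1 - v) / 2) * (ennreal (t * exp (- ((y + v) * t))) * indicator {0..} t) \<partial>lborel)"
        using True v by (intro nn_integral_cong) 
           (auto simp: indicator_def ennreal_mult'[symmetric] mult_ac)
      also have "\<dots> = ennreal (v * (1 - v) / 2) * ennreal (1 / (y + v)\<^sup>2)"
        by (subst nn_integral_cmult) (use True y nn_integral_t_exp[of "y + v"] in auto)
      also have "\<dots> = ennreal (v * (1 - v) / 2 / (y + v)\<^sup>2) * indicator {0..1} v"
        using True v by (simp add: ennreal_mult'[symmetric])
      finally show ?thesis .
    qed auto
  qed
  finally show "(\<integral>\<^sup>+t. ennreal (stirling_kernel t * exp (- (y * t))) * indicator {0..} t \<partial>lborel) = 
           ennreal (stirling_term y)" using v by simp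
qed

text \<open>The logarithmic derivative of the reflection formula for \<open>Gamma\<close> is Digamma
  (1 - z) - Digamma z = pi cot (pi z). The series of \<open>Digamma\<close>, taken at an imaginary
  z, turns this into the expansion of coth (t / 2).\<close>

lemma coth_partial_fractions:
  assumes t: "t > 0"
  shows "(\<lambda>n. 2 / (t\<^sup>2 + (2 * pi * real (Suc n))\<^sup>2)) sums (stirling_kernel t / (1 - exp (- t)))"
proof -
  define y where "y = t / (2 * pi)"
  \<comment> \<open>With z = i t / (2 pi), cot (pi z) becomes a multiple of coth (t / 2) and n^2 -
    z^2 becomes n^2 + y^2; being off the real axis, z avoids all poles.\<close>
  define z where "z = \<i> * complex_of_real y"
  have y: "y > 0" using t by (simp add: y_def)
  have znz: "z \<notin> \<int>" "1 - z \<notin> \<int>" "1 + z \<notin> \<int>"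
    using y by (auto elim!: Ints_cases simp: z_def complex_eq_iff)
  have nn: "w \<notin> \<int>\<^sub>\<le>\<^sub>0" if "w \<notin> \<int>" for w :: complex
    using that nonpos_Ints_subset_Ints by blast
  have sin_nz: "sin (of_real pi * z) \<noteq> 0"
    unfolding sin_eq_0 using y by (auto simp: z_def complex_eq_iff)
  have "((\<lambda>z::complex. Gamma z * Gamma (1 - z)) has_field_derivative 
           Gamma z * Digamma z * Gamma (1 - z) + Gamma (1 - z) * Digamma (1 - z) * (-1) * Gamma z) (at z)"
    using nn[OF znz(1)] nn[OF znz(2)]
    by (intro DERIV_mult'[THEN DERIV_cong] has_field_derivative_Gamma DERIV_chain2[OF has_field_derivative_Gamma])
       (auto intro!: derivative_eq_intros simp: algebra_simps)
  moreover have "((\<lambda>z::complex. Gamma z * Gamma (1 - z)) has_field_derivative 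
           - (of_real pi * of_real pi * cos (of_real pi * z)) / (sin (of_real pi * z))\<^sup>2) (at z)"
    unfolding Gamma_reflection_complex using sin_nz
    by (auto intro!: derivative_eq_intros simp: power2_eq_square)
  ultimately have "Gamma z * Digamma z * Gamma (1 - z) + Gamma (1 - z) * Digamma (1 - z) * (-1) * Gamma z = 
         - (of_real pi * of_real pi * cos (of_real pi * z)) / (sin (of_real pi * z))\<^sup>2"
    by (rule DERIV_unique)
  also have "Gamma z * Digamma z * Gamma (1 - z) + Gamma (1 - z) * Digamma (1 - z) * (-1) * Gamma z = 
     (Gamma z * Gamma (1 - z)) * (Digamma z - Digamma (1 - z))" by (simp add: algebra_simps)
  finally have eq: "of_real pi / sin (of_real pi * z) * (Digamma z - Digamma (1 - z)) = 
    - (of_real pi * of_real pi * cos (of_real pi * z)) / (sin (of_real pi * z))\<^sup>2"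
    unfolding Gamma_reflection_complex .
  have refl: "Digamma (1 - z) - Digamma z = of_real pi * cos (of_real pi * z) / sin (of_real pi * z)"
    (is "?b - ?a = ?P * ?C / ?S")
  proof -
    have "?b - ?a = - (?S / ?P) * (?P / ?S * (?a - ?b))" using sin_nz by simp
    also have "\<dots> = - (?S / ?P) * (- (?P * ?P * ?C) / ?S\<^sup>2)" by (simp only: eq)
    also have "\<dots> = ?P * ?C / ?S" using sin_nz by (simp add: power2_eq_square)
    finally show ?thesis .
  qed
  have D: "(\<lambda>n. inverse (of_nat (Suc n)) - inverse (w + of_nat n)) sums (Digamma w + euler_mascheroni)"
    if "w \<notin> \<int>\<^sub>\<le>\<^sub>0" for w :: complex
    using that summable_Digamma[of w] by (auto simp: Digamma_def sums_iff)
  have z0: "z \<noteq> 0" using y by (auto simp: z_def)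
  \<comment> \<open>Passing to \<open>Digamma (1 + z)\<close> lets the two series pair up over n >=
    1 into 2 y / (n^2 + y^2). The separated 1 / z becomes the subtracted 1 / y.\<close>
  have plus1: "Digamma (1 + z) = Digamma z + 1 / z"
    using Digamma_plus1[OF z0] by (simp add: add_ac)
  have refl': "Digamma (1 - z) - Digamma (1 + z) = 
                 of_real pi * cos (of_real pi * z) / sin (of_real pi * z) - 1 / z"
    unfolding plus1 refl[symmetric] by simp
  have "(\<lambda>n. inverse (1 + z + of_nat n) - inverse (1 - z + of_nat n)) sums (Digamma (1 - z) - Digamma (1 + z))"
    using sums_diff[OF D[OF nn[OF znz(2)]] D[OF nn[OF znz(3)]]] by simp
  hence "(\<lambda>n. \<i> * (inverse (1 + z + of_nat n) - inverse (1 - z + of_nat n))) sums 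
           (\<i> * (of_real pi * cos (of_real pi * z) / sin (of_real pi * z) - 1 / z))"
    unfolding refl' by (rule sums_mult)
  also have "(\<lambda>n. \<i> * (inverse (1 + z + of_nat n) - inverse (1 - z + of_nat n))) = 
             (\<lambda>n. of_real (2 * y / ((real (Suc n))\<^sup>2 + y\<^sup>2)))"
  proof
    fix n
    have "1 + z + of_nat n \<noteq> 0" "1 - z + of_nat n \<noteq> 0" using y by (auto simp: z_def complex_eq_iff)
    hence "\<i> * (inverse (1 + z + of_nat n) - inverse (1 - z + of_nat n)) = 
             - 2 * \<i> * z / ((1 + z + of_nat n) * (1 - z + of_nat n))"
      by (simp add: field_simps)
    also have "(1 + z + of_nat n) * (1 - z + of_nat n) = of_real ((real (Suc n))\<^sup>2 + y\<^sup>2)"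
      by (simp add: z_def power2_eq_square algebra_simps)
    also have "- 2 * \<i> * z = of_real (2 * y)" by (simp add: z_def)
    finally show "\<i> * (inverse (1 + z + of_nat n) - inverse (1 - z + of_nat n)) = of_real (2 * y / ((real (Suc n))\<^sup>2 + y\<^sup>2))"
      by simp
  qed
  also have "\<i> * (of_real pi * cos (of_real pi * z) / sin (of_real pi * z) - 1 / z) = 
             of_real (pi * (1 + exp (- t)) / (1 - exp (- t)) - 1 / y)"
  proof -
    have pz: "of_real pi * z = \<i> * of_real (t / 2)" using y by (simp add: z_def y_def)
    have e: "exp (- t) = exp (- (t / 2)) * exp (- (t / 2))" by (simp add: mult_exp_exp)
    have ne: "exp (t / 2) - exp (- (t / 2)) \<noteq> 0" using t by simp
    have C: "cos (of_real pi * z) = of_real ((exp (t / 2) + exp (- (t / 2))) / 2)"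
      unfolding pz cos_exp_eq by (simp add: exp_of_real[symmetric] mult.assoc[symmetric] add_ac)
    have S: "sin (of_real pi * z) = \<i> * of_real ((exp (t / 2) - exp (- (t / 2))) / 2)"
      unfolding pz sin_exp_eq by (simp add: exp_of_real[symmetric] mult.assoc[symmetric] field_simps)
    have "\<i> * (of_real pi * cos (of_real pi * z) / sin (of_real pi * z)) = 
        of_real (pi * ((exp (t / 2) + exp (- (t / 2))) / 2) / ((exp (t / 2) - exp (- (t / 2))) / 2))"
      unfolding C S by simp
    also have "pi * ((exp (t / 2) + exp (- (t / 2))) / 2) / ((exp (t / 2) - exp (- (t / 2))) / 2) = 
               pi * (1 + exp (- t)) / (1 - exp (- t))"
    proof -
      have "1 - exp (-t) \<noteq> 0" using t by simp
      moreover have "exp (t / 2) * exp (- (t / 2)) = 1" by (simp add: mult_exp_exp)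
      ultimately show ?thesis using ne unfolding e by (simp add: divide_simps) (simp add: algebra_simps)
    qed
    finally show ?thesis using y by (simp add: right_diff_distrib z_def)
  qed
  finally have "(\<lambda>n. 2 * y / ((real (Suc n))\<^sup>2 + y\<^sup>2)) sums (pi * (1 + exp (- t)) / (1 - exp (- t)) - 1 / y)"
    by (simp only: sums_of_real_iff)
  hence "(\<lambda>n. 1 / (2 * pi * t) * (2 * y / ((real (Suc n))\<^sup>2 + y\<^sup>2))) sums 
      (1 / (2 * pi * t) * (pi * (1 + exp (- t)) / (1 - exp (- t)) - 1 / y))"
    by (rule sums_mult)
  moreover have "1 / (2 * pi * t) * (2 * y / ((real (Suc n))\<^sup>2 + y\<^sup>2)) = 2 / (t\<^sup>2 + (2 * pi * real (Suc n))\<^sup>2)" for n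
  proof -
    have "t\<^sup>2 + (2 * pi * real (Suc n))\<^sup>2 = (2 * pi)\<^sup>2 * ((real (Suc n))\<^sup>2 + y\<^sup>2)"
      by (simp add: y_def field_simps power2_eq_square)
    moreover have "(real (Suc n))\<^sup>2 + y\<^sup>2 > 0" using y by (intro add_nonneg_pos) auto
    moreover have "1 / (2 * pi * (2 * pi * y)) * (2 * y / X) = 2 / ((2 * pi)\<^sup>2 * X)" if "X > 0" for X
      using y that by (simp add: field_simps power2_eq_square)
    moreover have "t = 2 * pi * y" by (simp add: y_def)
    ultimately show ?thesis by metis
  qed
  moreover have "1 / (2 * pi * t) * (pi * (1 + exp (- t)) / (1 - exp (- t)) - 1 / y) = stirling_kernel t / (1 - exp (- t))"
  proof -
    have "1 - exp (-t) \<noteq> 0" using t by simp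
    thus ?thesis using t by (simp add: y_def stirling_kernel_def divide_simps power2_eq_square) (simp add: algebra_simps)
  qed
  ultimately show ?thesis by simp
qed

section \<open>The sum of the Stirling terms and its Laplace transform\<close>

definition stirling_sum :: "real \<Rightarrow> real" where
  "stirling_sum x = (\<Sum>n. stirling_term (x + real n))"

lemma stirling_sum_measurable [measurable]: "stirling_sum \<in> borel_measurable borel"
  unfolding stirling_sum_def by measurable

lemma stirling_sum_nonneg: "x > 0 \<Longrightarrow> stirling_sum x \<ge> 0"
  unfolding stirling_sum_def
  by (intro suminf_nonneg summable_stirling_term stirling_term_conv_nn_integral(2)) auto

lemma stirling_sum_plus_1:
  assumes "x > 0"
  shows "stirling_sum x = stirling_term x + stirling_sum (x + 1)"
  using suminf_split_head[OF summable_stirling_term[OF assms]] by (simp add: stirling_sum_def add_ac)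

lemma nn_integral_exp_neg_Ioi:
  fixes z :: real
  assumes z: "z > 0"
  shows "(\<integral>\<^sup>+t. ennreal (exp (- (z * t))) * indicator {0<..} t \<partial>lborel) = ennreal (1 / z)"
  unfolding nn_integral_exp_neg[OF z, symmetric]
  by (intro nn_integral_cong_AE eventually_mono[OF AE_lborel_singleton[of 0]]) (auto simp: indicator_def)

text \<open>Summing exp (- (x + n) t) over n is a geometric series of ratio exp (- t), which is the
  origin of the denominator.\<close>

lemma stirling_sum_conv_nn_integral:
  assumes x: "x > 0"
  shows "ennreal (stirling_sum x) = 
           (\<integral>\<^sup>+t. ennreal (stirling_kernel t / (1 - exp (- t)) * exp (- (x * t))) * indicator {0..} t \<partial>lborel)"
proof -
  have "ennreal (stirling_sum x) = (\<Sum>n. ennreal (stirling_term (x + real n)))"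
    unfolding stirling_sum_def using x
    by (intro suminf_ennreal2[symmetric] summable_stirling_term stirling_term_conv_nn_integral(2)) auto
  also have "\<dots> = (\<Sum>n. \<integral>\<^sup>+t. ennreal (stirling_kernel t * exp (- ((x + real n) * t))) * indicator {0..} t \<partial>lborel)"
    using x by (intro suminf_cong stirling_term_conv_nn_integral(1)[symmetric]) auto
  also have "\<dots> = (\<integral>\<^sup>+t. (\<Sum>n. ennreal (stirling_kernel t * exp (- ((x + real n) * t))) * indicator {0..} t) \<partial>lborel)"
    by (rule nn_integral_suminf[symmetric]) measurable
  also have "\<dots> = (\<integral>\<^sup>+t. ennreal (stirling_kernel t / (1 - exp (- t)) * exp (- (x * t))) * indicator {0..} t \<partial>lborel)"
  proof (rule nn_integral_cong)
    fix t :: real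
    show "(\<Sum>n. ennreal (stirling_kernel t * exp (- ((x + real n) * t))) * indicator {0..} t) = 
            ennreal (stirling_kernel t / (1 - exp (- t)) * exp (- (x * t))) * indicator {0..} t"
    proof (cases "t > 0")
      case True
      have geom: "(\<lambda>n. stirling_kernel t * exp (- (x * t)) * exp (- t) ^ n) sums 
              (stirling_kernel t * exp (- (x * t)) * (1 / (1 - exp (- t))))"
        using True by (intro sums_mult geometric_sums) auto
      have "(\<lambda>n. stirling_kernel t * exp (- ((x + real n) * t))) sums 
              (stirling_kernel t / (1 - exp (- t)) * exp (- (x * t)))"
      proof -
        have "-((x + real n) * t) = - (x * t) + real n * (- t)" for n by (simp add: algebra_simps)
        hence "exp (- ((x + real n) * t)) = exp (- (x * t)) * exp (- t) ^ n" for n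
          by (simp only: exp_add exp_of_nat_mult)
        thus ?thesis using geom by (simp add: mult_ac)
      qed
      hence "(\<Sum>n. ennreal (stirling_kernel t * exp (- ((x + real n) * t)))) = 
               ennreal (stirling_kernel t / (1 - exp (- t)) * exp (- (x * t)))"
        by (rule suminf_ennreal_eq[rotated]) (use True stirling_kernel_nonneg[of t] in auto)
      thus ?thesis using True by simp
    next
      case False
      thus ?thesis by (auto simp: indicator_def stirling_kernel_def)
    qed
  qed
  finally show ?thesis .
qed

lemma nn_integral_partial_fraction:
  fixes a c :: real
  assumes a: "a > 0" and c: "c > 0"
  defines "T \<equiv> 2 * (ln (c / a) + pi * a / (2 * c)) / (a\<^sup>2 + c\<^sup>2)"
  shows "(\<integral>\<^sup>+t. ennreal (2 / (t\<^sup>2 + c\<^sup>2) * (1 / (a + t))) * indicator {0..} t \<partial>lborel) = ennreal T"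
    and "T \<ge> 0"
proof -
  \<comment> \<open>From (a^2 + c^2) / ((a + t) (t^2 + c^2)) = 1 / (a + t) - t / (t^2 + c^2) + a /
    (t^2 + c^2). At infinity the logarithms cancel and arctan contributes pi / 2.\<close>
  define F where "F = (\<lambda>t. 2 * (ln (a + t) - ln (t\<^sup>2 + c\<^sup>2) / 2 + (a / c) * arctan (t / c)) / (a\<^sup>2 + c\<^sup>2))"
  have "(\<integral>\<^sup>+t. ennreal (2 / (t\<^sup>2 + c\<^sup>2) * (1 / (a + t))) * indicator {0..} t \<partial>lborel) = 
          ennreal (2 * (pi * a / (2 * c)) / (a\<^sup>2 + c\<^sup>2) - F 0)"
  proof (rule nn_integral_FTC_atLeast[where F = F])
    fix t :: real assume t: "0 \<le> t"
    have pos: "a + t > 0" "t\<^sup>2 + c\<^sup>2 > 0" "a\<^sup>2 + c\<^sup>2 > 0" using a c t by (auto intro: add_nonneg_pos)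
    have "(F has_real_derivative 2 * (1 / (a + t) - (2 * t) / (t\<^sup>2 + c\<^sup>2) / 2 + (a / c) * (1 / (1 + (t / c)\<^sup>2) * (1 / c))) / (a\<^sup>2 + c\<^sup>2)) (at t)"
    proof -
      have d1: "((\<lambda>t. ln (a + t)) has_real_derivative 1 / (a + t)) (at t)"
        using pos by (auto intro!: derivative_eq_intros)
      have d2: "((\<lambda>t. ln (t\<^sup>2 + c\<^sup>2)) has_real_derivative (2 * t) / (t\<^sup>2 + c\<^sup>2)) (at t)"
        using pos by (auto intro!: derivative_eq_intros)
      have d3: "((\<lambda>t. arctan (t / c)) has_real_derivative 1 / (1 + (t / c)\<^sup>2) * (1 / c)) (at t)"
        using c by (auto intro!: derivative_eq_intros simp: divide_inverse)
      show ?thesis unfolding F_def by (intro DERIV_cdivide DERIV_cmult DERIV_add DERIV_diff d1 d2 d3)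
    qed
    also have "1 / (1 + (t / c)\<^sup>2) * (1 / c) = c / (t\<^sup>2 + c\<^sup>2)"
      using c pos by (simp add: divide_simps) (simp add: power2_eq_square algebra_simps)
    also have "2 * (1 / (a + t) - (2 * t) / (t\<^sup>2 + c\<^sup>2) / 2 + (a / c) * (c / (t\<^sup>2 + c\<^sup>2))) / (a\<^sup>2 + c\<^sup>2) = 
                 2 / (t\<^sup>2 + c\<^sup>2) * (1 / (a + t))"
    proof -
      have "1 / (a + t) - (2 * t) / (t\<^sup>2 + c\<^sup>2) / 2 + (a / c) * (c / (t\<^sup>2 + c\<^sup>2)) = (a\<^sup>2 + c\<^sup>2) / ((t\<^sup>2 + c\<^sup>2) * (a + t))"
        using c pos by (simp add: divide_simps) (simp add: power2_eq_square algebra_simps)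
      moreover have "2 * (S / (X * Y)) / S = 2 / X * (1 / Y)" if "S \<noteq> 0" for S X Y :: real
        using that by simp
      ultimately show ?thesis using pos by (metis less_irrefl)
    qed
    finally show "(F has_real_derivative 2 / (t\<^sup>2 + c\<^sup>2) * (1 / (a + t))) (at t)" .
    show "0 \<le> 2 / (t\<^sup>2 + c\<^sup>2) * (1 / (a + t))" using a t by simp
  next
    have "((\<lambda>t. ln (a + t) - ln (t\<^sup>2 + c\<^sup>2) / 2) \<longlongrightarrow> 0) at_top"
      using a c by real_asymp
    moreover have "((\<lambda>t. arctan (t / c)) \<longlongrightarrow> pi / 2) at_top"
      using c by real_asymp
    ultimately have "(F \<longlongrightarrow> 2 * (0 + (a / c) * (pi / 2)) / (a\<^sup>2 + c\<^sup>2)) at_top"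
      unfolding F_def using a c by (intro tendsto_intros) (auto simp: sum_power2_eq_zero_iff)
    thus "(F \<longlongrightarrow> 2 * (pi * a / (2 * c)) / (a\<^sup>2 + c\<^sup>2)) at_top" by (simp add: mult_ac)
  qed auto
  also have "2 * (pi * a / (2 * c)) / (a\<^sup>2 + c\<^sup>2) - F 0 = T"
    using a c by (simp add: F_def T_def ln_div ln_realpow diff_divide_distrib add_divide_distrib distrib_left right_diff_distrib)
  finally show "(\<integral>\<^sup>+t. ennreal (2 / (t\<^sup>2 + c\<^sup>2) * (1 / (a + t))) * indicator {0..} t \<partial>lborel) = ennreal T" .
  \<comment> \<open>An equation in \<open>ennreal\<close> does not reveal the sign of T. It follows
    from ln u <= u - 1 and 1 < pi / 2.\<close>
  have "ln (a / c) \<le> a / c - 1" using a c by (intro ln_le_minus_one) auto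
  also have "a / c \<le> pi * a / (2 * c)" using a c pi_gt3 by (simp add: field_simps)
  finally have "ln (c / a) + pi * a / (2 * c) \<ge> 0" using a c by (simp add: ln_div)
  thus "T \<ge> 0" unfolding T_def by (intro divide_nonneg_nonneg mult_nonneg_nonneg) auto
qed

text \<open>Tonelli: the integral over x turns the exponential into 1 / (a + t), after which the
  partial fractions of coth are integrated term by term. The finite total gives
  integrability.\<close>

lemma laplace_stirling_sum:
  fixes a :: real
  assumes a: "a > 0"
  defines "c \<equiv> (\<lambda>n. 2 * pi * real (Suc n))"
  defines "d \<equiv> (\<lambda>n. 2 * (ln (c n / a) + pi * a / (2 * c n)) / (a\<^sup>2 + (c n)\<^sup>2))"
  shows "summable d"
    and "has_bochner_integral lborel (\<lambda>x. indicator {0<..} x * (stirling_sum x * exp (- (a * x)))) (\<Sum>n. d n)"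
proof -
  have c: "c n > 0" for n by (simp add: c_def)
  have d_nonneg: "d n \<ge> 0" for n
    using nn_integral_partial_fraction(2)[OF a c] by (simp add: d_def)
  \<comment> \<open>The terms are of order ln n / n^2, which n powr (-3/2) dominates.\<close>
  have "d \<in> O(\<lambda>n. real n powr (-3/2))"
    unfolding d_def c_def using a by real_asymp
  thus summable: "summable d"
    by (rule summable_comparison_test_bigo[rotated]) (simp add: summable_real_powr_iff)
  let ?k = "\<lambda>t. stirling_kernel t / (1 - exp (- t))"
  have k_nonneg: "?k t \<ge> 0" if "t \<ge> 0" for t
    using stirling_kernel_nonneg[OF that] that by simp
  have "(\<integral>\<^sup>+x. ennreal (indicator {0<..} x * (stirling_sum x * exp (- (a * x)))) \<partial>lborel) = 
        (\<integral>\<^sup>+x. (\<integral>\<^sup>+t. ennreal (?k t * exp (- ((a + t) * x))) * indicator {0..} t * indicator {0<..} x \<partial>lborel) \<partial>lborel)"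
  proof (rule nn_integral_cong)
    fix x :: real
    show "ennreal (indicator {0<..} x * (stirling_sum x * exp (- (a * x)))) = 
          (\<integral>\<^sup>+t. ennreal (?k t * exp (- ((a + t) * x))) * indicator {0..} t * indicator {0<..} x \<partial>lborel)"
    proof (cases "x > 0")
      case True
      have "ennreal (indicator {0<..} x * (stirling_sum x * exp (- (a * x)))) = 
              ennreal (exp (- (a * x))) * ennreal (stirling_sum x)"
        using True by (simp add: ennreal_mult''[symmetric] mult.commute stirling_sum_nonneg)
      also have "\<dots> = (\<integral>\<^sup>+t. ennreal (exp (- (a * x))) * (ennreal (?k t * exp (- (x * t))) * indicator {0..} t) \<partial>lborel)"
        unfolding stirling_sum_conv_nn_integral[OF True] by (rule nn_integral_cmult[symmetric]) measurable
      also have "\<dots> = (\<integral>\<^sup>+t. ennreal (?k t * exp (- ((a + t) * x))) * indicator {0..} t * indicator {0<..} x \<partial>lborel)"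
        using True by (intro nn_integral_cong) 
          (auto simp: indicator_def ennreal_mult'[symmetric] exp_add[symmetric] algebra_simps)
      finally show ?thesis .
    qed auto
  qed
  also have "\<dots> = (\<integral>\<^sup>+t. (\<integral>\<^sup>+x. ennreal (?k t * exp (- ((a + t) * x))) * indicator {0..} t * indicator {0<..} x \<partial>lborel) \<partial>lborel)"
    by (rule lborel_pair.Fubini') measurable
  also have "\<dots> = (\<integral>\<^sup>+t. ennreal (?k t * (1 / (a + t))) * indicator {0..} t \<partial>lborel)"
  proof (rule nn_integral_cong)
    fix t :: real
    show "(\<integral>\<^sup>+x. ennreal (?k t * exp (- ((a + t) * x))) * indicator {0..} t * indicator {0<..} x \<partial>lborel) = 
          ennreal (?k t * (1 / (a + t))) * indicator {0..} t"
    proof (cases "t \<ge> 0")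
      case True
      have "(\<integral>\<^sup>+x. ennreal (?k t * exp (- ((a + t) * x))) * indicator {0..} t * indicator {0<..} x \<partial>lborel) = 
            (\<integral>\<^sup>+x. ennreal (?k t) * (ennreal (exp (- ((a + t) * x))) * indicator {0<..} x) \<partial>lborel)"
        using True k_nonneg[OF True] by (intro nn_integral_cong) (auto simp: ennreal_mult mult.assoc simp del: times_divide_eq_left)
      also have "\<dots> = ennreal (?k t) * ennreal (1 / (a + t))"
        by (subst nn_integral_cmult) (use a True nn_integral_exp_neg_Ioi[of "a + t"] in auto)
      also have "\<dots> = ennreal (?k t * (1 / (a + t))) * indicator {0..} t"
        using True k_nonneg[OF True] by (simp add: ennreal_mult'[symmetric])
      finally show ?thesis .
    qed auto
  qed
  also have "\<dots> = (\<integral>\<^sup>+t. (\<Sum>n. ennreal (2 / (t\<^sup>2 + (c n)\<^sup>2) * (1 / (a + t))) * indicator {0..} t) \<partial>lborel)"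
  \<comment> \<open>At t = 0 the left side is 0 by division by zero while the series is positive; a
    single point is negligible.\<close>
  proof (rule nn_integral_cong_AE, rule eventually_mono[OF AE_lborel_singleton[of 0]])
    fix t :: real assume t0: "t \<noteq> 0"
    show "ennreal (?k t * (1 / (a + t))) * indicator {0..} t = 
            (\<Sum>n. ennreal (2 / (t\<^sup>2 + (c n)\<^sup>2) * (1 / (a + t))) * indicator {0..} t)"
    proof (cases "t > 0")
      case True
      have "(\<lambda>n. 2 / (t\<^sup>2 + (c n)\<^sup>2) * (1 / (a + t))) sums (?k t * (1 / (a + t)))"
        unfolding c_def by (intro sums_mult2 coth_partial_fractions True)
      hence "(\<Sum>n. ennreal (2 / (t\<^sup>2 + (c n)\<^sup>2) * (1 / (a + t)))) = ennreal (?k t * (1 / (a + t)))"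
        by (rule suminf_ennreal_eq[rotated]) (use True a in auto)
      thus ?thesis using True by simp
    qed (use t0 in \<open>auto simp: indicator_def\<close>)
  qed
  also have "\<dots> = (\<Sum>n. \<integral>\<^sup>+t. ennreal (2 / (t\<^sup>2 + (c n)\<^sup>2) * (1 / (a + t))) * indicator {0..} t \<partial>lborel)"
    by (rule nn_integral_suminf) measurable
  also have "\<dots> = (\<Sum>n. ennreal (d n))"
    unfolding nn_integral_partial_fraction(1)[OF a c] d_def ..
  also have "\<dots> = ennreal (\<Sum>n. d n)"
    by (rule suminf_ennreal2[OF d_nonneg summable])
  finally have "(\<integral>\<^sup>+x. ennreal (indicator {0<..} x * (stirling_sum x * exp (- (a * x)))) \<partial>lborel) = ennreal (\<Sum>n. d n)" .
  thus "has_bochner_integral lborel (\<lambda>x. indicator {0<..} x * (stirling_sum x * exp (- (a * x)))) (\<Sum>n. d n)"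
    by (intro has_bochner_integral_nn_integral suminf_nonneg summable d_nonneg)
       (auto simp: indicator_def stirling_sum_nonneg)
qed

section \<open>Laplace transforms\<close>

lemma has_bochner_integral_Gamma:
  assumes s: "s > (0::real)"
  shows "has_bochner_integral lborel (\<lambda>t. indicator {0..} t * t powr (s - 1) / exp t) (Gamma s)"
proof (rule has_bochner_integral_nn_integral)
  show "(\<integral>\<^sup>+t. ennreal (indicator {0..} t * t powr (s - 1) / exp t) \<partial>lborel) = ennreal (Gamma s)"
    using Gamma_conv_nn_integral_real[OF s] by simp
qed (use s in \<open>auto simp: Gamma_real_nonneg indicator_def\<close>)

text \<open>Euler's integral differentiated under the integral sign: dominated convergence is
  applied to the difference quotients along the steps 1 / (n + 1).\<close>

lemma has_bochner_integral_Gamma_deriv: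
  assumes s: "s \<ge> (1::real)"
  shows "has_bochner_integral lborel (\<lambda>t. indicator {0..} t * t powr (s - 1) / exp t * ln t) (Gamma s * Digamma s)"
proof -
  let ?g = "\<lambda>s t::real. indicator {0..} t * t powr (s - 1) / exp t"
  define h where "h = (\<lambda>n. inverse (real (Suc n)))"
  have h: "h n > 0" "h n \<le> 1" for n by (auto simp: h_def field_simps)
  define f where "f = (\<lambda>n t. (?g (s + h n) t - ?g s t) / h n)"
  \<comment> \<open>The majorant comes from |(t powr h - 1) / h| <= 2 t powr (-1/2) + t^2 for 0 < h
    <= 1: near 0 the quotient is at most - ln t in modulus, for t >= 1 at most ln t * t powr h. The
    two summands shift s by -1/2 and +2, and s >= 1 keeps both Gamma integrals convergent.\<close>
  define w where "w = (\<lambda>t. 2 * ?g (s - 1 / 2) t + ?g (s + 2) t)"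
  have int: "integrable lborel (?g s)" "integral\<^sup>L lborel (?g s) = Gamma s" if "s > 0" for s
    using has_bochner_integral_Gamma[OF that] by (auto simp: has_bochner_integral_iff)
  have w: "integrable lborel w"
    unfolding w_def by (intro Bochner_Integration.integrable_add integrable_mult_right int) (use s in auto)
  have lim: "(\<lambda>n. f n t) \<longlonglongrightarrow> ?g s t * ln t" for t
  proof (cases "t > 0")
    case True
    have "((\<lambda>x. t powr x) has_real_derivative t powr 0 * ln t) (at 0)"
      using True by (auto intro!: derivative_eq_intros)
    hence "((\<lambda>x. (t powr (0 + x) - t powr 0) / x) \<longlongrightarrow> ln t) (at 0)"
      using True by (simp add: DERIV_def)
    moreover have "filterlim h (at 0) sequentially"
      unfolding h_def filterlim_at using LIMSEQ_inverse_real_of_nat by auto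
    ultimately have "(\<lambda>n. (t powr (0 + h n) - t powr 0) / h n) \<longlonglongrightarrow> ln t"
      by (rule filterlim_compose)
    hence "(\<lambda>n. ?g s t * ((t powr (0 + h n) - t powr 0) / h n)) \<longlonglongrightarrow> ?g s t * ln t"
      by (intro tendsto_intros)
    moreover have "?g s t * ((t powr (0 + h n) - t powr 0) / h n) = f n t" for n
      using True by (simp add: f_def powr_add powr_diff divide_simps) (simp add: algebra_simps)
    ultimately show ?thesis by simp
  next
    case False
    hence "f n t = 0" for n unfolding f_def by (cases "t = 0") auto
    moreover have "?g s t * ln t = 0" using False by (cases "t = 0") auto
    ultimately show ?thesis by (simp only: tendsto_const)
  qed
  have bound: "norm (f n t) \<le> w t" for n t
  proof (cases "t > 0")
    case True
    have eq: "f n t = ?g s t * ((t powr h n - 1) / h n)"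
      using True by (simp add: f_def powr_add powr_diff divide_simps) (simp add: algebra_simps)
    have le: "\<bar>(t powr h n - 1) / h n\<bar> \<le> 2 * t powr (- 1 / 2) + t\<^sup>2"
    proof (cases "t \<ge> 1")
      case True
      have "1 - h n * ln t \<le> t powr (- h n)"
        using exp_ge_add_one_self[of "- h n * ln t"] \<open>t > 0\<close> by (simp add: powr_def)
      hence "t powr h n * (1 - h n * ln t) \<le> t powr h n * t powr (- h n)"
        by (intro mult_left_mono) auto
      also have "t powr h n * t powr (- h n) = 1" using \<open>t > 0\<close> by (simp add: powr_add[symmetric])
      finally have "(t powr h n - 1) / h n \<le> ln t * t powr h n"
        using h(1)[of n] by (simp add: field_simps)
      also have "\<dots> \<le> t * t powr 1"
        using True h[of n] ln_le_minus_one[of t] by (intro mult_mono powr_mono) auto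
      also have "\<dots> = t\<^sup>2" using True by (simp add: power2_eq_square)
      finally have "(t powr h n - 1) / h n \<le> t\<^sup>2" .
      moreover have "(t powr h n - 1) / h n \<ge> 0" using True h(1)[of n] by (simp add: ge_one_powr_ge_zero)
      ultimately have "\<bar>(t powr h n - 1) / h n\<bar> \<le> t\<^sup>2" by linarith
      thus ?thesis by (smt (verit) powr_ge_zero)
    next
      case False
      have "1 + h n * ln t \<le> t powr h n"
        using exp_ge_add_one_self[of "h n * ln t"] \<open>t > 0\<close> by (simp add: powr_def)
      hence "(t powr h n - 1) / h n \<ge> ln t" using h(1)[of n] by (simp add: field_simps)
      moreover have "(t powr h n - 1) / h n \<le> 0"
        using False \<open>t > 0\<close> h(1)[of n] powr_le1[of "h n" t] by (simp add: divide_nonpos_pos)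
      moreover have "- ln t \<le> 2 * t powr (- 1 / 2)"
        using ln_le_minus_one[of "t powr (- 1 / 2)"] \<open>t > 0\<close> by (simp add: ln_powr)
      moreover have "t\<^sup>2 \<ge> 0" by simp
      ultimately show ?thesis by linarith
    qed
    have nonneg: "?g s t \<ge> 0" by simp
    hence "norm (f n t) = ?g s t * \<bar>(t powr h n - 1) / h n\<bar>"
      by (simp only: eq real_norm_def abs_mult abs_of_nonneg)
    also have "\<dots> \<le> ?g s t * (2 * t powr (- 1 / 2) + t\<^sup>2)"
      by (rule mult_left_mono[OF le nonneg])
    also have "\<dots> = w t"
    proof -
      have "s - 1 / 2 - 1 = (s - 1) + (- 1 / 2)" "s + 2 - 1 = (s - 1) + 2" by simp_all
      hence "t powr (s - 1 / 2 - 1) = t powr (s - 1) * t powr (- 1 / 2)" 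
            "t powr (s + 2 - 1) = t powr (s - 1) * t powr 2"
        by (simp_all only: powr_add)
      moreover have "t powr 2 = t\<^sup>2" using True by (simp add: powr_numeral)
      ultimately show ?thesis using True
        by (simp only: w_def) (simp add: distrib_left add_divide_distrib)
    qed
    finally show ?thesis .
  next
    case False
    hence "f n t = 0" unfolding f_def by (cases "t = 0") auto
    moreover have "w t \<ge> 0" by (simp add: w_def)
    ultimately show ?thesis by simp
  qed
  have f_int: "integral\<^sup>L lborel (f n) = (Gamma (s + h n) - Gamma s) / h n" for n
    unfolding f_def using s h[of n] int[of s] int[of "s + h n"] by simp
  have [measurable]: "f n \<in> borel_measurable lborel" for n unfolding f_def by measurable
  have conv: "integrable lborel (\<lambda>t. ?g s t * ln t)" 
       "(\<lambda>n. integral\<^sup>L lborel (f n)) \<longlonglongrightarrow> integral\<^sup>L lborel (\<lambda>t. ?g s t * ln t)"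
    by (rule integrable_dominated_convergence[where s = f and w = w], measurable, rule w, rule AE_I2, rule lim, rule AE_I2, rule bound,
        rule integral_dominated_convergence[where s = f and w = w], measurable, rule w, rule AE_I2, rule lim, rule AE_I2, rule bound)
  have "(Gamma has_real_derivative (Gamma s * Digamma s)) (at s)"
    using s by (intro has_field_derivative_Gamma) (auto dest: nonpos_Ints_nonpos)
  hence "((\<lambda>x. (Gamma (s + x) - Gamma s) / x) \<longlongrightarrow> Gamma s * Digamma s) (at 0)"
    by (simp add: DERIV_def)
  moreover have "filterlim h (at 0) sequentially"
    unfolding h_def filterlim_at using LIMSEQ_inverse_real_of_nat by auto
  ultimately have "(\<lambda>n. (Gamma (s + h n) - Gamma s) / h n) \<longlonglongrightarrow> Gamma s * Digamma s"
    by (rule filterlim_compose)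
  hence "integral\<^sup>L lborel (\<lambda>t. ?g s t * ln t) = Gamma s * Digamma s"
    using conv(2) LIMSEQ_unique unfolding f_int by blast
  with conv(1) show ?thesis by (simp add: has_bochner_integral_iff)
qed

lemma has_bochner_integral_scale:
  fixes f :: "real \<Rightarrow> real"
  assumes "has_bochner_integral lborel f I" "a > 0"
  shows "has_bochner_integral lborel (\<lambda>x. f (a * x)) (I / a)"
  using lborel_integral_real_affine[of a f 0] lborel_integrable_real_affine[of f a 0] assms
  by (auto simp: has_bochner_integral_iff field_simps)

text \<open>Scaling by a in the Gamma integrals; ln (a x) = ln a + ln x accounts for the term - ln
  a. The closed and the open half-line give the same function because
  \<open>0 powr _ = 0\<close>.\<close>

lemma laplace_powr:
  fixes a :: real
  assumes a: "a > 0" and s: "s \<ge> 1"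
  shows "has_bochner_integral lborel (\<lambda>x. indicator {0<..} x * (x powr (s - 1) * exp (- (a * x)))) 
           (Gamma s / a powr s)" (is ?th1)
    and "has_bochner_integral lborel (\<lambda>x. indicator {0<..} x * (x powr (s - 1) * ln x * exp (- (a * x)))) 
           (Gamma s * (Digamma s - ln a) / a powr s)" (is ?th2)
proof -
  have "has_bochner_integral lborel (\<lambda>x. a powr (1 - s) * (indicator {0..} (a * x) * (a * x) powr (s - 1) / exp (a * x)))
          (a powr (1 - s) * (Gamma s / a))"
    using s a by (intro has_bochner_integral_mult_right has_bochner_integral_scale[OF has_bochner_integral_Gamma]) auto
  also have "(\<lambda>x. a powr (1 - s) * (indicator {0..} (a * x) * (a * x) powr (s - 1) / exp (a * x))) = 
             (\<lambda>x. indicator {0<..} x * (x powr (s - 1) * exp (- (a * x))))"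
    using a by (auto simp: fun_eq_iff indicator_def powr_mult powr_diff exp_minus zero_le_mult_iff field_simps)
  also have eq: "a powr (1 - s) * (Gamma s / a) = Gamma s / a powr s"
    using a by (simp add: powr_diff)
  finally show 1: ?th1 .
  have "has_bochner_integral lborel (\<lambda>x. a powr (1 - s) * (indicator {0..} (a * x) * (a * x) powr (s - 1) / exp (a * x) * ln (a * x)))
          (a powr (1 - s) * (Gamma s * Digamma s / a))"
    using s a by (intro has_bochner_integral_mult_right has_bochner_integral_scale[OF has_bochner_integral_Gamma_deriv]) auto
  also have "(\<lambda>x. a powr (1 - s) * (indicator {0..} (a * x) * (a * x) powr (s - 1) / exp (a * x) * ln (a * x))) = 
             (\<lambda>x. indicator {0<..} x * (x powr (s - 1) * exp (- (a * x)) * (ln x + ln a)))"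
    using a by (auto simp: fun_eq_iff indicator_def powr_mult powr_diff exp_minus zero_le_mult_iff field_simps ln_mult)
  finally have "has_bochner_integral lborel (\<lambda>x. indicator {0<..} x * (x powr (s - 1) * exp (- (a * x)) * (ln x + ln a)) - 
         ln a * (indicator {0<..} x * (x powr (s - 1) * exp (- (a * x)))))
      (a powr (1 - s) * (Gamma s * Digamma s / a) - ln a * (Gamma s / a powr s))"
    by (intro has_bochner_integral_diff has_bochner_integral_mult_right 1)
  also have "a powr (1 - s) * (Gamma s * Digamma s / a) - ln a * (Gamma s / a powr s) = Gamma s * (Digamma s - ln a) / a powr s"
    using a by (simp add: powr_diff field_simps)
  finally show ?th2 by (simp add: algebra_simps)
qed

lemma laplace_elementary:
  fixes a :: real
  assumes a: "a > 0"
  shows "has_bochner_integral lborel (\<lambda>x. indicator {0<..} x * (x * exp (- (a * x)))) (1 / a\<^sup>2)"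
    and "has_bochner_integral lborel (\<lambda>x. indicator {0<..} x * (ln x * exp (- (a * x)))) 
           (- (euler_mascheroni + ln a) / a)"
    and "has_bochner_integral lborel (\<lambda>x. indicator {0<..} x * (x * ln x * exp (- (a * x)))) 
           ((1 - euler_mascheroni - ln a) / a\<^sup>2)"
proof -
  have D2: "Digamma (2::real) = 1 - euler_mascheroni"
    using Digamma_plus1[of "1::real"] by simp
  have G2: "Gamma (2::real) = 1" using Gamma_fact[of 1, where ?'a = real] by simp
  have p2: "a powr 2 = a\<^sup>2" using a by (simp add: powr_numeral)
  have 1: "(\<lambda>x. indicator {0<..} x * (x powr (2 - 1) * exp (- (a * x)))) = 
             (\<lambda>x. indicator {0<..} x * (x * exp (- (a * x))))"
    and 2: "(\<lambda>x. indicator {0<..} x * (x powr (1 - 1) * ln x * exp (- (a * x)))) = 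
             (\<lambda>x. indicator {0<..} x * (ln x * exp (- (a * x))))"
    and 3: "(\<lambda>x. indicator {0<..} x * (x powr (2 - 1) * ln x * exp (- (a * x)))) = 
             (\<lambda>x. indicator {0<..} x * (x * ln x * exp (- (a * x)) :: real))"
    by (auto simp: fun_eq_iff indicator_def)
  show "has_bochner_integral lborel (\<lambda>x. indicator {0<..} x * (x * exp (- (a * x)))) (1 / a\<^sup>2)"
    using laplace_powr(1)[OF a, of 2] unfolding 1 by (simp add: G2 p2)
  show "has_bochner_integral lborel (\<lambda>x. indicator {0<..} x * (ln x * exp (- (a * x)))) 
           (- (euler_mascheroni + ln a) / a)"
    using laplace_powr(2)[OF a, of 1] a unfolding 2 by simp
  show "has_bochner_integral lborel (\<lambda>x. indicator {0<..} x * (x * ln x * exp (- (a * x)))) 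
           ((1 - euler_mascheroni - ln a) / a\<^sup>2)"
    using laplace_powr(2)[OF a, of 2] unfolding 3 by (simp add: G2 p2 D2)
qed

section \<open>Integrals of the derivative at 0 against exponentials\<close>

text \<open>By Lerch's formula this is ln Gamma(x) - ln (2 pi) / 2.\<close>

definition zeta_deriv_0 :: "real \<Rightarrow> real" where
  "zeta_deriv_0 x = x * ln x - x - ln x / 2 + stirling_sum x"

lemma deriv_hurwitz_zeta_0: "x > 0 \<Longrightarrow> deriv (hurwitz_zeta x) 0 = of_real (zeta_deriv_0 x)"
  unfolding zeta_deriv_0_def stirling_sum_def by (rule deriv_hurwitz_zeta_0_series)

lemma zeta_deriv_0_measurable [measurable]: "zeta_deriv_0 \<in> borel_measurable borel"
  unfolding zeta_deriv_0_def by measurable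

lemma zeta_deriv_0_plus_1:
  assumes "x > 0"
  shows "zeta_deriv_0 (x + 1) = zeta_deriv_0 x + ln x"
proof -
  have eq: "stirling_sum (x + 1) = stirling_sum x - stirling_term x"
    using stirling_sum_plus_1[OF assms] by linarith
  show ?thesis unfolding zeta_deriv_0_def eq stirling_term_def by (simp add: field_simps)
qed

lemma laplace_zeta_deriv_0:
  fixes a :: real
  assumes a: "a > 0"
  defines "c \<equiv> (\<lambda>n. 2 * pi * real (Suc n))"
  shows "(\<lambda>n. 2 * (euler_mascheroni + ln (c n) + pi * a / (2 * c n)) / (a\<^sup>2 + (c n)\<^sup>2)) sums 
           ((LINT x|lborel. indicator {0<..} x * (zeta_deriv_0 x * exp (- (a * x)))) + 
            (euler_mascheroni + ln a) / (a * (exp a - 1)))" (is ?th1)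
    and "integrable lborel (\<lambda>x. indicator {0<..} x * (zeta_deriv_0 x * exp (- (a * x))))" (is ?th2)
proof -
  define d where "d = (\<lambda>n. 2 * (ln (c n / a) + pi * a / (2 * c n)) / (a\<^sup>2 + (c n)\<^sup>2))"
  define g where "g = euler_mascheroni + ln a"
  have ea: "1 - exp (- a) \<noteq> 0" "exp a - 1 \<noteq> 0" using a by auto
  have d: "summable d"
    "has_bochner_integral lborel (\<lambda>x. indicator {0<..} x * (stirling_sum x * exp (- (a * x)))) (\<Sum>n. d n)"
    using laplace_stirling_sum[OF a] unfolding d_def c_def by simp_all
  have "has_bochner_integral lborel (\<lambda>x. indicator {0<..} x * (x * ln x * exp (- (a * x))) - 
          indicator {0<..} x * (x * exp (- (a * x))) - 1 / 2 * (indicator {0<..} x * (ln x * exp (- (a * x)))) + 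
          indicator {0<..} x * (stirling_sum x * exp (- (a * x)))) 
        ((1 - euler_mascheroni - ln a) / a\<^sup>2 - 1 / a\<^sup>2 - 1 / 2 * (- (euler_mascheroni + ln a) / a) + (\<Sum>n. d n))"
    by (intro has_bochner_integral_add has_bochner_integral_diff has_bochner_integral_mult_right laplace_elementary[OF a] d(2))
  also have "(\<lambda>x. indicator {0<..} x * (x * ln x * exp (- (a * x))) - 
          indicator {0<..} x * (x * exp (- (a * x))) - 1 / 2 * (indicator {0<..} x * (ln x * exp (- (a * x)))) + 
          indicator {0<..} x * (stirling_sum x * exp (- (a * x)))) = 
          (\<lambda>x. indicator {0<..} x * (zeta_deriv_0 x * exp (- (a * x))))"
    by (auto simp: fun_eq_iff zeta_deriv_0_def algebra_simps)
  also have "(1 - euler_mascheroni - ln a) / a\<^sup>2 - 1 / a\<^sup>2 - 1 / 2 * (- (euler_mascheroni + ln a) / a) + (\<Sum>n. d n) = 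
             (\<Sum>n. d n) + g / (2 * a) - g / a\<^sup>2"
    by (simp add: g_def diff_divide_distrib add_divide_distrib)
  finally have L: "has_bochner_integral lborel (\<lambda>x. indicator {0<..} x * (zeta_deriv_0 x * exp (- (a * x)))) 
       ((\<Sum>n. d n) + g / (2 * a) - g / a\<^sup>2)" .
  thus ?th2 by (simp add: has_bochner_integral_iff)
  \<comment> \<open>Adding g times the coth series at a replaces \<open>ln (c n / a)\<close> by
    \<open>euler_mascheroni + ln (c n)\<close>. Its sum absorbs the elementary terms g / (2 a) - g /
    a^2, up to g / (a (exp a - 1)).\<close>
  have "(\<lambda>n. d n + g * (2 / (a\<^sup>2 + (c n)\<^sup>2))) sums ((\<Sum>n. d n) + g * (stirling_kernel a / (1 - exp (- a))))"
    unfolding c_def by (intro sums_add sums_mult coth_partial_fractions a summable_sums d(1))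
  moreover have "d n + g * (2 / (a\<^sup>2 + (c n)\<^sup>2)) = 2 * (euler_mascheroni + ln (c n) + pi * a / (2 * c n)) / (a\<^sup>2 + (c n)\<^sup>2)" for n
  proof -
    have "c n > 0" by (simp add: c_def)
    hence "ln (c n / a) = ln (c n) - ln a" using a by (simp add: ln_div)
    hence "d n = 2 * (ln (c n) - ln a + pi * a / (2 * c n)) / (a\<^sup>2 + (c n)\<^sup>2)" by (simp add: d_def)
    moreover have "2 * (C - A + R) / D + (E + A) * (2 / D) = 2 * (E + C + R) / D" for A C D E R :: real
      by (simp add: add_divide_distrib[symmetric] algebra_simps)
    ultimately show ?thesis by (simp only: g_def)
  qed
  moreover have "g * (stirling_kernel a / (1 - exp (- a))) = g / (2 * a) - g / a\<^sup>2 + g / (a * (exp a - 1))"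
  proof -
    have "stirling_kernel a / (1 - exp (- a)) = (1 + exp (- a)) / (1 - exp (- a)) / (2 * a) - 1 / a\<^sup>2"
    proof -
      have "(A / (2 * a) - E / a\<^sup>2) / E = A / E / (2 * a) - 1 / a\<^sup>2" if "E \<noteq> 0" for A E
        using that by (simp add: diff_divide_distrib mult.commute)
      from this[OF ea(1)] show ?thesis by (simp add: stirling_kernel_def)
    qed
    also have "(1 + exp (- a)) / (1 - exp (- a)) = 1 + 2 / (exp a - 1)"
      using ea by (simp add: exp_minus divide_simps)
    also have "(1 + 2 / (exp a - 1)) / (2 * a) - 1 / a\<^sup>2 = 1 / (2 * a) - 1 / a\<^sup>2 + 1 / (a * (exp a - 1))"
      using ea a by (simp add: add_divide_distrib)
    finally have eq: "stirling_kernel a / (1 - exp (- a)) = 1 / (2 * a) - 1 / a\<^sup>2 + 1 / (a * (exp a - 1))" .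
    show ?thesis unfolding eq by (simp add: right_diff_distrib distrib_left)
  qed
  moreover have "(\<Sum>n. d n) + (g / (2 * a) - g / a\<^sup>2 + g / (a * (exp a - 1))) = 
      (LINT x|lborel. indicator {0<..} x * (zeta_deriv_0 x * exp (- (a * x)))) + g / (a * (exp a - 1))"
    using L by (simp add: has_bochner_integral_iff)
  ultimately show ?th1 by (simp only: g_def)
qed

text \<open>Taken from the Laplace transform at a = 1, since exp 1 * exp (- x) >= 1 on the unit
  interval.\<close>

lemma integrable_zeta_deriv_0: "integrable lborel (\<lambda>x. indicator {0<..<1} x * zeta_deriv_0 x)"
proof -
  have "integrable lborel (\<lambda>x. indicator {0<..} x * (zeta_deriv_0 x * exp (- (1 * x))))"
    by (rule laplace_zeta_deriv_0(2)) simp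
  hence "integrable lborel (\<lambda>x. exp 1 * (indicator {0<..} x * (zeta_deriv_0 x * exp (- (1 * x)))))"
    by (rule integrable_mult_right)
  thus ?thesis
  proof (rule Bochner_Integration.integrable_bound, measurable)
    have "norm (indicator {0<..<1} x * zeta_deriv_0 x) \<le> norm (exp 1 * (indicator {0<..} x * (zeta_deriv_0 x * exp (- (1 * x)))))" for x
    proof (cases "x \<in> {0<..<1}")
      case True
      have "exp 1 * exp (-x) \<ge> 1" using True by (simp add: exp_add[symmetric])
      hence "\<bar>zeta_deriv_0 x\<bar> * 1 \<le> \<bar>zeta_deriv_0 x\<bar> * (exp 1 * exp (-x))" by (intro mult_left_mono) auto
      thus ?thesis using True by (simp add: abs_mult mult_ac)
    qed auto
    thus "AE x in lborel. norm (indicator {0<..<1} x * zeta_deriv_0 x) \<le> norm (exp 1 * (indicator {0<..} x * (zeta_deriv_0 x * exp (- (1 * x)))))"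
      by simp
  qed
qed

text \<open>Let M = - g / a be the transform of ln. Translation by 1 gives I = L - exp (- a) (L +
  M), and - exp (- a) M equals 1 - exp (- a) times g / (a (exp a - 1)), precisely the surplus in
  \<open>laplace_zeta_deriv_0\<close>. Thus no ln a survives.\<close>

lemma integral_exp_zeta_deriv_0:
  fixes a :: real
  assumes a: "a > 0"
  defines "c \<equiv> (\<lambda>n. 2 * pi * real (Suc n))"
  shows "(LINT x|lborel. indicator {0<..<1} x * (zeta_deriv_0 x * exp (- (a * x)))) = 
    (1 - exp (- a)) * (\<Sum>n. 2 * (euler_mascheroni + ln (c n) + pi * a / (2 * c n)) / (a\<^sup>2 + (c n)\<^sup>2))"
proof -
  let ?G = "\<lambda>x. zeta_deriv_0 x * exp (- (a * x))"
  define I where "I = (LINT x|lborel. indicator {0<..<1} x * ?G x)"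
  define L where "L = (LINT x|lborel. indicator {0<..} x * ?G x)"
  define g where "g = euler_mascheroni + ln a"
  define S where "S = (\<Sum>n. 2 * (euler_mascheroni + ln (c n) + pi * a / (2 * c n)) / (a\<^sup>2 + (c n)\<^sup>2))"
  have Lint: "integrable lborel (\<lambda>x. indicator {0<..} x * ?G x)" by (rule laplace_zeta_deriv_0(2)[OF a])
  have S: "S = L + g / (a * (exp a - 1))"
    unfolding S_def L_def g_def c_def using laplace_zeta_deriv_0(1)[OF a] by (rule sums_unique[symmetric])
  have M: "has_bochner_integral lborel (\<lambda>x. indicator {0<..} x * (ln x * exp (- (a * x)))) (- g / a)"
    unfolding g_def by (rule laplace_elementary(2)[OF a])
  have int1: "integrable lborel (\<lambda>x. indicator {0<..<1} x * ?G x)"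
    by (rule Bochner_Integration.integrable_bound[OF Lint]) (auto simp: indicator_def)
  have int2: "integrable lborel (\<lambda>x. indicator {1<..} x * ?G x)"
    by (rule Bochner_Integration.integrable_bound[OF Lint]) (auto simp: indicator_def)
  have "L = (LINT x|lborel. indicator {0<..<1} x * ?G x + indicator {1<..} x * ?G x)"
    unfolding L_def
    by (intro integral_cong_AE eventually_mono[OF AE_lborel_singleton[of 1]]) (auto simp: indicator_def)
  also have "\<dots> = I + (LINT x|lborel. indicator {1<..} x * ?G x)"
    unfolding I_def by (rule Bochner_Integration.integral_add[OF int1 int2])
  also have "(LINT x|lborel. indicator {1<..} x * ?G x) = (LINT x|lborel. indicator {1<..} (1 + 1 * x) * ?G (1 + 1 * x))"
    by (subst lborel_integral_real_affine[of 1 _ 1]) auto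
  also have "\<dots> = (LINT x|lborel. exp (- a) * (indicator {0<..} x * ?G x + indicator {0<..} x * (ln x * exp (- (a * x)))))"
  proof (rule Bochner_Integration.integral_cong[OF refl])
    fix x :: real
    show "indicator {1<..} (1 + 1 * x) * ?G (1 + 1 * x) = 
            exp (- a) * (indicator {0<..} x * ?G x + indicator {0<..} x * (ln x * exp (- (a * x))))"
    proof (cases "x > 0")
      case True
      have "exp (- (a * (1 + 1 * x))) = exp (- a) * exp (- (a * x))" by (simp add: exp_add[symmetric] algebra_simps)
      thus ?thesis using True zeta_deriv_0_plus_1[OF True] by (simp add: algebra_simps)
    qed auto
  qed
  also have "\<dots> = exp (- a) * (L + (- g / a))"
    using M Lint by (simp add: has_bochner_integral_iff L_def)
  finally have "I = (1 - exp (- a)) * L + exp (- a) * g / a" by (simp add: algebra_simps)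
  also have "exp (- a) * g / a = (1 - exp (- a)) * (g / (a * (exp a - 1)))"
  proof -
    have "exp a - 1 \<noteq> 0" using a by simp
    moreover have "exp (- a) * (exp a - 1) = 1 - exp (- a)" by (simp add: exp_minus field_simps)
    ultimately have "(1 - exp (- a)) / (exp a - 1) = exp (- a)" by (simp add: field_simps)
    moreover have "(1 - exp (- a)) * (g / (a * (exp a - 1))) = (1 - exp (- a)) / (exp a - 1) * g / a" by simp
    ultimately show ?thesis by simp
  qed
  finally show ?thesis unfolding I_def[symmetric] S_def[symmetric] S by (simp add: algebra_simps)
qed

section \<open>Power series in the parameter\<close>

text \<open>Finite geometric sums give an exact remainder, so no double series has to be rearranged:
  the K-th partial sum differs from the limit by the sum of \<open>c n * q n ^ K\<close>, which is
  at most \<open>norm u ^ K\<close> times the sum of the norms of \<open>c n\<close>.\<close>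

lemma geometric_partial_fractions_sums:
  fixes w :: "nat \<Rightarrow> real" and u :: complex
  assumes w: "summable (\<lambda>n. \<bar>w n\<bar> / real (Suc n) ^ 2)" and u: "norm u < 1"
    and Z: "\<And>k. (\<lambda>n. of_real (w n) / of_nat (Suc n) ^ (2 * k + 2)) sums Z k"
  shows "(\<lambda>k. (-1) ^ k * Z k * u ^ k) sums (\<Sum>n. of_real (w n) / (of_nat (Suc n) ^ 2 + u))"
    and "summable (\<lambda>n. of_real (w n) / (of_nat (Suc n) ^ 2 + u))"
proof -
  define c where "c = (\<lambda>n. of_real (w n) / (of_nat (Suc n) ^ 2 + u))"
  define q where "q = (\<lambda>n. - u / of_nat (Suc n) ^ 2)"
  have N1: "1 \<le> real (Suc n) ^ 2" for n by (rule one_le_power) simp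
  have denom: "norm (of_nat (Suc n) ^ 2 + u) \<ge> real (Suc n) ^ 2 * (1 - norm u)" for n
  proof -
    have "norm (of_nat (Suc n) ^ 2 :: complex) - norm u \<le> norm (of_nat (Suc n) ^ 2 + u)"
      by (rule norm_diff_ineq)
    moreover have "norm (of_nat (Suc n) ^ 2 :: complex) = real (Suc n) ^ 2" by (simp only: norm_power norm_of_nat)
    moreover have "1 * norm u \<le> real (Suc n) ^ 2 * norm u" by (rule mult_right_mono[OF N1]) simp
    ultimately show ?thesis by (simp only: right_diff_distrib)
  qed
  have pos: "real (Suc n) ^ 2 * (1 - norm u) > 0" for n using u by simp
  have nz: "of_nat (Suc n) ^ 2 + u \<noteq> 0" for n using denom[of n] pos[of n] by (metis less_le_not_le norm_zero)
  have c_le: "norm (c n) \<le> (1 / (1 - norm u)) * (\<bar>w n\<bar> / real (Suc n) ^ 2)" for n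
  proof -
    have "norm (c n) = \<bar>w n\<bar> / norm (of_nat (Suc n) ^ 2 + u)" by (simp only: c_def norm_divide norm_of_real)
    also have "\<dots> \<le> \<bar>w n\<bar> / (real (Suc n) ^ 2 * (1 - norm u))"
    proof (rule divide_left_mono[OF denom abs_ge_zero])
      have "norm (of_nat (Suc n) ^ 2 + u) > 0" using pos[of n] denom[of n] by linarith
      thus "0 < norm (of_nat (Suc n) ^ 2 + u) * (real (Suc n) ^ 2 * (1 - norm u))" using pos[of n] by (rule mult_pos_pos)
    qed
    finally show ?thesis by (simp add: mult.commute)
  qed
  have sn: "summable (\<lambda>n. norm (c n))"
    by (rule summable_comparison_test'[OF summable_mult[OF w, of "1 / (1 - norm u)"], of 0]) (use c_le in simp)
  hence sc: "summable c" by (rule summable_norm_cancel)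
  thus "summable (\<lambda>n. of_real (w n) / (of_nat (Suc n) ^ 2 + u))" by (simp add: c_def)
  have q: "norm (q n) \<le> norm u" for n
  proof -
    have "norm (q n) = norm u / real (Suc n) ^ 2"
      by (simp only: q_def norm_divide norm_minus_cancel norm_power norm_of_nat)
    also have "\<dots> \<le> norm u / 1" by (rule divide_left_mono[OF N1]) auto
    finally show ?thesis by simp
  qed
  have rem_le: "norm (c n * q n ^ K) \<le> norm (c n) * norm u ^ K" for n K
    using q[of n] by (auto simp: norm_mult norm_power intro!: mult_left_mono power_mono)
  have sr: "summable (\<lambda>n. norm (c n * q n ^ K))" for K
    by (rule summable_comparison_test'[OF summable_mult2[OF sn, of "norm u ^ K"], of 0]) (use rem_le in simp)
  have partial: "(\<Sum>k<K. (-1) ^ k * Z k * u ^ k) = (\<Sum>n. c n) - (\<Sum>n. c n * q n ^ K)" for K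
  proof -
    have "(\<lambda>n. \<Sum>k<K. (-1) ^ k * (of_real (w n) / of_nat (Suc n) ^ (2 * k + 2)) * u ^ k) sums 
            (\<Sum>k<K. (-1) ^ k * Z k * u ^ k)"
      by (intro sums_sum sums_mult sums_mult2 Z)
    moreover have "(\<Sum>k<K. (-1) ^ k * (of_real (w n) / of_nat (Suc n) ^ (2 * k + 2)) * u ^ k) = c n - c n * q n ^ K" for n
    proof -
      define M where "M = (of_nat (Suc n) ^ 2 :: complex)"
      have M: "M \<noteq> 0" "M + u \<noteq> 0" using nz[of n] by (auto simp: M_def simp del: of_nat_Suc)
      have q1: "q n \<noteq> 1" 
      proof
        assume "q n = 1"
        hence "- u = M" using M(1) by (simp add: q_def M_def[symmetric] field_simps del: of_nat_Suc)
        thus False using M(2) by (metis add.right_inverse add.commute)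
      qed
      have "(-1) ^ k * (of_real (w n) / of_nat (Suc n) ^ (2 * k + 2)) * u ^ k = of_real (w n) / M * q n ^ k" for k
      proof -
        have 1: "of_nat (Suc n) ^ (2 * k + 2) = M ^ k * M" by (simp only: M_def power_add power_mult)
        have 2: "q n ^ k = (-1) ^ k * u ^ k / M ^ k"
          by (simp only: q_def M_def[symmetric] power_divide power_minus[of u])
        show ?thesis unfolding 1 2 by (simp add: mult_ac)
      qed
      hence "(\<Sum>k<K. (-1) ^ k * (of_real (w n) / of_nat (Suc n) ^ (2 * k + 2)) * u ^ k) = 
               of_real (w n) / M * (\<Sum>k<K. q n ^ k)" by (simp add: sum_distrib_left)
      also have "(\<Sum>k<K. q n ^ k) = (1 - q n ^ K) / (1 - q n)" using q1 by (simp add: sum_gp_strict)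
      also have "of_real (w n) / M * ((1 - q n ^ K) / (1 - q n)) = c n * (1 - q n ^ K)"
      proof -
        have "M * (1 - q n) = M + u" using M(1) by (simp add: q_def M_def[symmetric] distrib_left del: of_nat_Suc)
        hence "of_real (w n) / M * ((1 - q n ^ K) / (1 - q n)) = of_real (w n) / (M + u) * (1 - q n ^ K)" 
          by (simp only: times_divide_times_eq) simp
        thus ?thesis by (simp add: c_def M_def)
      qed
      finally show ?thesis by (simp add: right_diff_distrib)
    qed
    ultimately have "(\<lambda>n. c n - c n * q n ^ K) sums (\<Sum>k<K. (-1) ^ k * Z k * u ^ k)" by simp
    moreover have "(\<lambda>n. c n - c n * q n ^ K) sums ((\<Sum>n. c n) - (\<Sum>n. c n * q n ^ K))"
      by (intro sums_diff summable_sums sc summable_norm_cancel[OF sr])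
    ultimately show ?thesis by (rule sums_unique2)
  qed
  have "(\<lambda>K. \<Sum>n. c n * q n ^ K) \<longlonglongrightarrow> 0"
  proof (rule Lim_null_comparison)
    show "\<forall>\<^sub>F K in sequentially. norm (\<Sum>n. c n * q n ^ K) \<le> (\<Sum>n. norm (c n)) * norm u ^ K"
    proof (intro always_eventually allI)
      fix K
      have "norm (\<Sum>n. c n * q n ^ K) \<le> (\<Sum>n. norm (c n * q n ^ K))" by (rule summable_norm[OF sr])
      also have "\<dots> \<le> (\<Sum>n. norm (c n) * norm u ^ K)"
        by (intro suminf_le rem_le sr summable_mult2 sn)
      also have "\<dots> = (\<Sum>n. norm (c n)) * norm u ^ K" using sn by (rule suminf_mult2[symmetric])
      finally show "norm (\<Sum>n. c n * q n ^ K) \<le> (\<Sum>n. norm (c n)) * norm u ^ K" .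
    qed
    show "(\<lambda>K. (\<Sum>n. norm (c n)) * norm u ^ K) \<longlonglongrightarrow> 0"
      using u by (intro tendsto_mult_right_zero LIMSEQ_power_zero) auto
  qed
  hence "(\<lambda>K. (\<Sum>n. c n) - (\<Sum>n. c n * q n ^ K)) \<longlonglongrightarrow> (\<Sum>n. c n) - 0"
    by (intro tendsto_intros)
  thus "(\<lambda>k. (-1) ^ k * Z k * u ^ k) sums (\<Sum>n. of_real (w n) / (of_nat (Suc n) ^ 2 + u))"
    unfolding sums_def partial c_def by simp
qed

text \<open>In the application \<open>u\<close> is \<open>p\<^sup>2\<close>.\<close>
definition pf_series :: "(nat \<Rightarrow> real) \<Rightarrow> complex \<Rightarrow> complex" where
  "pf_series w u = (\<Sum>n. of_real (w n) / (of_nat (Suc n) ^ 2 + u))"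

lemma pf_series_holomorphic:
  fixes w :: "nat \<Rightarrow> real" and Z :: "nat \<Rightarrow> complex"
  assumes w: "summable (\<lambda>n. \<bar>w n\<bar> / real (Suc n) ^ 2)"
    and Z: "\<And>k. (\<lambda>n. of_real (w n) / of_nat (Suc n) ^ (2 * k + 2)) sums Z k"
  shows "pf_series w holomorphic_on ball 0 1"
proof (rule power_series_holomorphic)
  fix u :: complex assume "u \<in> ball 0 1"
  thus "(\<lambda>k. ((-1) ^ k * Z k) * (u - 0) ^ k) sums pf_series w u"
    using geometric_partial_fractions_sums(1)[OF w _ Z, of u] by (simp add: pf_series_def)
qed

lemma summable_weights:
  "summable (\<lambda>n. \<bar>1 :: real\<bar> / real (Suc n) ^ 2)"
  "summable (\<lambda>n. \<bar>1 / real (Suc n)\<bar> / real (Suc n) ^ 2)"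
  "summable (\<lambda>n. \<bar>ln (real (Suc n))\<bar> / real (Suc n) ^ 2)"
proof -
  have *: "summable f" if "f \<in> O(\<lambda>n. real n powr (-3/2))" for f :: "nat \<Rightarrow> real"
    by (rule summable_comparison_test_bigo[OF _ that]) (simp add: summable_real_powr_iff)
  show "summable (\<lambda>n. \<bar>1 :: real\<bar> / real (Suc n) ^ 2)"
    by (rule *) real_asymp
  show "summable (\<lambda>n. \<bar>1 / real (Suc n)\<bar> / real (Suc n) ^ 2)"
    by (rule *) real_asymp
  show "summable (\<lambda>n. \<bar>ln (real (Suc n))\<bar> / real (Suc n) ^ 2)"
    by (rule *) real_asymp
qed

text \<open>One weight for each series of the theorem: 1 / n raises the exponent by one, and ln n
  comes with a minus sign from differentiating n powr - s.\<close>

lemma zeta_weight_sums: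
  "(\<lambda>n. of_real 1 / of_nat (Suc n) ^ (2 * k + 2)) sums zeta (of_nat (2 * k + 2))"
  "(\<lambda>n. of_real (1 / real (Suc n)) / of_nat (Suc n) ^ (2 * k + 2)) sums zeta (of_nat (2 * k + 3))"
  "(\<lambda>n. of_real (ln (real (Suc n))) / of_nat (Suc n) ^ (2 * k + 2)) sums (- deriv zeta (of_nat (2 * k + 2)))"
proof -
  show "(\<lambda>n. of_real 1 / of_nat (Suc n) ^ (2 * k + 2)) sums zeta (of_nat (2 * k + 2))"
    using zeta_of_nat_sums[of "2 * k + 2"] by (simp del: of_nat_Suc)
  have e: "2 * k + 3 = Suc (2 * k + 2)" by simp
  show "(\<lambda>n. of_real (1 / real (Suc n)) / of_nat (Suc n) ^ (2 * k + 2)) sums zeta (of_nat (2 * k + 3))"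
    using zeta_of_nat_sums[of "2 * k + 3"] unfolding e power_Suc by (simp del: of_nat_Suc power_Suc)
  show "(\<lambda>n. of_real (ln (real (Suc n))) / of_nat (Suc n) ^ (2 * k + 2)) sums (- deriv zeta (of_nat (2 * k + 2)))"
    using sums_minus[OF deriv_zeta_of_nat_sums[of "2 * k + 2"]] by (simp del: of_nat_Suc)
qed

section \<open>Analytic continuation in the parameter and the final identity\<close>

definition exp_moment :: "complex \<Rightarrow> complex" where
  "exp_moment z = (LINT x|lborel. indicator {0<..<1} x *\<^sub>R (exp (- 2 * of_real pi * z * of_real x) * of_real (zeta_deriv_0 x)))"

text \<open>The logarithmic singularity at x = 0 rules out
  \<open>holomorphic_on_integral_param\<close>. Instead the exponential is expanded and integrated
  term by term; on the unit interval every moment is dominated by the integral of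
  |\<open>zeta_deriv_0\<close>|.\<close>

lemma exp_moment_holomorphic: "exp_moment holomorphic_on UNIV"
proof -
  let ?g = "\<lambda>x. indicator {0<..<1} x * zeta_deriv_0 x"
  define m where "m = (\<lambda>k. (LINT x|lborel. complex_of_real (x ^ k * ?g x)))"
  have g: "integrable lborel ?g" by (rule integrable_zeta_deriv_0)
  have gk: "integrable lborel (\<lambda>x. x ^ k * ?g x)" for k
    by (rule Bochner_Integration.integrable_bound[OF g])
       (auto simp: indicator_def abs_mult power_abs intro!: mult_left_le_one_le power_le_one)
  have sums: "(\<lambda>k. ((- 2 * of_real pi) ^ k / fact k * m k) * z ^ k) sums exp_moment z" for z
  proof -
    define f where "f = (\<lambda>k x. (- 2 * of_real pi * z) ^ k / fact k * complex_of_real (x ^ k * ?g x))"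
    have f: "integrable lborel (f k)" for k
      unfolding f_def by (intro integrable_mult_right) (simp only: complex_of_real_integrable_eq gk)
    have norm_f: "norm (f k x) \<le> (2 * pi * norm z) ^ k / fact k * \<bar>?g x\<bar>" for k x
    proof -
      have "norm (- 2 * of_real pi * z) = 2 * pi * norm z" by (simp add: norm_mult)
      hence "norm (f k x) = (2 * pi * norm z) ^ k / fact k * \<bar>x ^ k * ?g x\<bar>"
        by (simp only: f_def norm_mult[of "_ / _"] norm_divide norm_power norm_fact norm_of_real)
      also have "\<bar>x ^ k * ?g x\<bar> \<le> \<bar>?g x\<bar>"
        by (cases "x \<in> {0<..<1}") (auto simp: abs_mult intro!: mult_left_le_one_le power_le_one)
      hence "(2 * pi * norm z) ^ k / fact k * \<bar>x ^ k * ?g x\<bar> \<le> (2 * pi * norm z) ^ k / fact k * \<bar>?g x\<bar>"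
        by (rule mult_left_mono) auto
      finally show ?thesis .
    qed
    have sexp: "summable (\<lambda>k. (2 * pi * norm z) ^ k / fact k)"
      using summable_exp[of "2 * pi * norm z"] by (simp add: divide_inverse mult.commute)
    have "(\<lambda>k. integral\<^sup>L lborel (f k)) sums (\<integral>x. (\<Sum>k. f k x) \<partial>lborel)"
    proof (rule sums_integral[OF f])
      show "AE x in lborel. summable (\<lambda>k. norm (f k x))"
      proof (rule AE_I2)
        fix x :: real
        show "summable (\<lambda>k. norm (f k x))"
          by (rule summable_comparison_test'[OF summable_mult2[OF sexp, of "\<bar>?g x\<bar>"], of 0]) (use norm_f in simp)
      qed
      show "summable (\<lambda>k. \<integral>x. norm (f k x) \<partial>lborel)"
      proof (rule summable_comparison_test'[OF summable_mult2[OF sexp, of "\<integral>x. \<bar>?g x\<bar> \<partial>lborel"], of 0])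
        fix k :: nat
        have "(\<integral>x. norm (f k x) \<partial>lborel) \<le> (\<integral>x. (2 * pi * norm z) ^ k / fact k * \<bar>?g x\<bar> \<partial>lborel)"
          using f g norm_f by (intro integral_mono integrable_norm integrable_mult_right integrable_abs) auto
        thus "norm (\<integral>x. norm (f k x) \<partial>lborel) \<le> (2 * pi * norm z) ^ k / fact k * (\<integral>x. \<bar>?g x\<bar> \<partial>lborel)"
          by simp
      qed
    qed
    also have "(\<lambda>k. integral\<^sup>L lborel (f k)) = (\<lambda>k. ((- 2 * of_real pi) ^ k / fact k * m k) * z ^ k)"
    proof
      fix k
      have "integral\<^sup>L lborel (f k) = (- 2 * of_real pi * z) ^ k / fact k * m k"
        unfolding f_def m_def by (rule integral_mult_right_zero)
      also have "\<dots> = ((- 2 * of_real pi) ^ k / fact k * m k) * z ^ k"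
        unfolding power_mult_distrib[of "- 2 * of_real pi" z k] by simp
      finally show "integral\<^sup>L lborel (f k) = ((- 2 * of_real pi) ^ k / fact k * m k) * z ^ k" .
    qed
    also have "(\<integral>x. (\<Sum>k. f k x) \<partial>lborel) = exp_moment z"
      unfolding exp_moment_def
    proof (rule Bochner_Integration.integral_cong[OF refl])
      fix x :: real
      have "(\<lambda>k. (- 2 * of_real pi * z * of_real x) ^ k /\<^sub>R fact k * of_real (?g x)) sums 
              (exp (- 2 * of_real pi * z * of_real x) * of_real (?g x))"
        by (intro sums_mult2 exp_converges)
      moreover have "(- 2 * of_real pi * z * of_real x) ^ k /\<^sub>R fact k * of_real (?g x) = f k x" for k
        unfolding f_def power_mult_distrib[of "- 2 * of_real pi * z"]
        by (simp add: scaleR_conv_of_real divide_inverse)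
      ultimately have "(\<Sum>k. f k x) = exp (- 2 * of_real pi * z * of_real x) * of_real (?g x)"
        by (simp only: sums_unique[symmetric])
      thus "(\<Sum>k. f k x) = indicator {0<..<1} x *\<^sub>R (exp (- 2 * of_real pi * z * of_real x) * of_real (zeta_deriv_0 x))"
        by (simp add: indicator_def)
    qed
    finally show ?thesis .
  qed
  have "exp_moment holomorphic_on ball 0 r" for r
    by (rule power_series_holomorphic[where a = "\<lambda>k. (- 2 * of_real pi) ^ k / fact k * m k"]) (use sums in simp)
  hence "exp_moment field_differentiable at z" for z
    by (rule holomorphic_on_imp_differentiable_at[of _ "ball 0 (norm z + 1)"]) auto
  thus ?thesis by (simp add: holomorphic_on_def field_differentiable_at_within)
qed

lemma exp_moment_of_real:
  assumes p: "0 < p" "p < 1"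
  shows "exp_moment (of_real p) = (1 - exp (- 2 * of_real pi * of_real p)) / (2 * of_real pi ^ 2) *
     (of_real (ln (2 * pi) + euler_mascheroni) * pf_series (\<lambda>n. 1) ((of_real p)\<^sup>2) + 
      of_real (pi / 2) * (of_real p * pf_series (\<lambda>n. 1 / real (Suc n)) ((of_real p)\<^sup>2)) + 
      pf_series (\<lambda>n. ln (real (Suc n))) ((of_real p)\<^sup>2))"
proof -
  define a where "a = 2 * pi * p"
  have a: "a > 0" using p by (simp add: a_def)
  have u: "norm ((of_real p :: complex)\<^sup>2) < 1" 
    using p by (simp add: norm_power abs_square_less_1)
  have real: "(\<lambda>n. w n / ((real (Suc n))\<^sup>2 + p\<^sup>2)) sums S" 
    if "summable (\<lambda>n. \<bar>w n\<bar> / real (Suc n) ^ 2)" 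
       "\<And>k. (\<lambda>n. of_real (w n) / of_nat (Suc n) ^ (2 * k + 2)) sums Z k" 
       "S = (\<Sum>n. w n / ((real (Suc n))\<^sup>2 + p\<^sup>2))" for w :: "nat \<Rightarrow> real" and Z :: "nat \<Rightarrow> complex" and S
  proof -
    have "(\<lambda>n. of_real (w n) / (of_nat (Suc n) ^ 2 + (of_real p)\<^sup>2)) = (\<lambda>n. complex_of_real (w n / ((real (Suc n))\<^sup>2 + p\<^sup>2)))"
      by simp
    with geometric_partial_fractions_sums(2)[OF that(1) u that(2)]
    have "summable (\<lambda>n. complex_of_real (w n / ((real (Suc n))\<^sup>2 + p\<^sup>2)))" by simp
    hence "summable (\<lambda>n. w n / ((real (Suc n))\<^sup>2 + p\<^sup>2))" by (simp only: summable_complex_of_real)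
    thus ?thesis using that(3) by (simp add: summable_sums)
  qed
  have pf: "pf_series w ((of_real p)\<^sup>2) = of_real (\<Sum>n. w n / ((real (Suc n))\<^sup>2 + p\<^sup>2))"
    if "(\<lambda>n. w n / ((real (Suc n))\<^sup>2 + p\<^sup>2)) sums (\<Sum>n. w n / ((real (Suc n))\<^sup>2 + p\<^sup>2))" for w
    using sums_unique[OF sums_of_real[OF that, where ?'a = complex]] by (simp add: pf_series_def)
  define S where "S = (\<lambda>w. \<Sum>n. w n / ((real (Suc n))\<^sup>2 + p\<^sup>2))"
  note s1 = real[OF summable_weights(1) zeta_weight_sums(1) refl]
  note s2 = real[OF summable_weights(2) zeta_weight_sums(2) refl]
  note s3 = real[OF summable_weights(3) zeta_weight_sums(3) refl]
  have "(\<lambda>n. (1 / (2 * pi\<^sup>2)) * ((ln (2 * pi) + euler_mascheroni) * (1 / ((real (Suc n))\<^sup>2 + p\<^sup>2)) + 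
           pi / 2 * (p * ((1 / real (Suc n)) / ((real (Suc n))\<^sup>2 + p\<^sup>2))) + 
           ln (real (Suc n)) / ((real (Suc n))\<^sup>2 + p\<^sup>2))) sums 
        ((1 / (2 * pi\<^sup>2)) * ((ln (2 * pi) + euler_mascheroni) * S (\<lambda>n. 1) + 
           pi / 2 * (p * S (\<lambda>n. 1 / real (Suc n))) + S (\<lambda>n. ln (real (Suc n)))))"
    unfolding S_def by (intro sums_mult sums_add s1 s2 s3)
  moreover have "(1 / (2 * pi\<^sup>2)) * ((ln (2 * pi) + euler_mascheroni) * (1 / ((real (Suc n))\<^sup>2 + p\<^sup>2)) + 
           pi / 2 * (p * ((1 / real (Suc n)) / ((real (Suc n))\<^sup>2 + p\<^sup>2))) + 
           ln (real (Suc n)) / ((real (Suc n))\<^sup>2 + p\<^sup>2)) = 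
         2 * (euler_mascheroni + ln (2 * pi * real (Suc n)) + pi * a / (2 * (2 * pi * real (Suc n)))) / (a\<^sup>2 + (2 * pi * real (Suc n))\<^sup>2)" for n
  proof -
    define N where "N = real (Suc n)"
    define D where "D = N\<^sup>2 + p\<^sup>2"
    have N: "N > 0" by (simp add: N_def)
    have D: "D > 0" using N by (simp add: D_def add_pos_nonneg)
    \<comment> \<open>With a = 2 pi p every denominator acquires the factor 4 pi^2, and 2 / (4 pi^2)
      is the prefactor 1 / (2 pi^2).\<close>
    have 1: "a\<^sup>2 + (2 * pi * N)\<^sup>2 = 4 * pi\<^sup>2 * D" by (simp add: a_def D_def power2_eq_square algebra_simps)
    have 2: "ln (2 * pi * N) = ln (2 * pi) + ln N" using N by (intro ln_mult_pos) auto
    have 3: "pi * a / (2 * (2 * pi * N)) = pi * p / (2 * N)" using N by (simp add: a_def)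
    have "(1 / (2 * pi\<^sup>2)) * ((ln (2 * pi) + euler_mascheroni) * (1 / D) + pi / 2 * (p * ((1 / N) / D)) + ln N / D) = 
            2 * (euler_mascheroni + ln (2 * pi * N) + pi * a / (2 * (2 * pi * N))) / (a\<^sup>2 + (2 * pi * N)\<^sup>2)"
      unfolding 1 2 3 using N D by (simp add: field_simps)
    thus ?thesis by (simp only: N_def D_def)
  qed
  ultimately have sum: "(\<Sum>n. 2 * (euler_mascheroni + ln (2 * pi * real (Suc n)) + pi * a / (2 * (2 * pi * real (Suc n)))) / (a\<^sup>2 + (2 * pi * real (Suc n))\<^sup>2)) = 
       (1 / (2 * pi\<^sup>2)) * ((ln (2 * pi) + euler_mascheroni) * S (\<lambda>n. 1) + 
           pi / 2 * (p * S (\<lambda>n. 1 / real (Suc n))) + S (\<lambda>n. ln (real (Suc n))))"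
    by (simp add: sums_iff)
  have "exp_moment (of_real p) = (LINT x|lborel. complex_of_real (indicator {0<..<1} x * (zeta_deriv_0 x * exp (- (a * x)))))"
    unfolding exp_moment_def
    by (rule Bochner_Integration.integral_cong[OF refl])
       (simp add: indicator_def a_def exp_of_real[symmetric] mult_ac)
  also have "\<dots> = of_real ((1 - exp (- a)) * ((1 / (2 * pi\<^sup>2)) * ((ln (2 * pi) + euler_mascheroni) * S (\<lambda>n. 1) + 
           pi / 2 * (p * S (\<lambda>n. 1 / real (Suc n))) + S (\<lambda>n. ln (real (Suc n))))))"
    unfolding integral_complex_of_real integral_exp_zeta_deriv_0[OF a] sum ..
  finally have *: "exp_moment (of_real p) = of_real ((1 - exp (- a)) * ((1 / (2 * pi\<^sup>2)) * ((ln (2 * pi) + euler_mascheroni) * S (\<lambda>n. 1) + 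
           pi / 2 * (p * S (\<lambda>n. 1 / real (Suc n))) + S (\<lambda>n. ln (real (Suc n))))))" .
  have PF: "pf_series (\<lambda>n. 1) ((of_real p)\<^sup>2) = of_real (S (\<lambda>n. 1))"
    "pf_series (\<lambda>n. 1 / real (Suc n)) ((of_real p)\<^sup>2) = of_real (S (\<lambda>n. 1 / real (Suc n)))"
    "pf_series (\<lambda>n. ln (real (Suc n))) ((of_real p)\<^sup>2) = of_real (S (\<lambda>n. ln (real (Suc n))))"
    unfolding S_def by (rule pf, rule s1, rule pf, rule s2, rule pf, rule s3)
  have E: "1 - exp (- 2 * of_real pi * of_real p) = complex_of_real (1 - exp (- a))"
    by (simp add: a_def exp_of_real[symmetric])
  show ?thesis unfolding * PF E by simp
qed

text \<open>The identity theorem carries the formula from the real segment (0, 1) to the disc.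
  Keeping 1 - exp (- 2 pi z) as a factor makes both sides holomorphic at z = 0 too.\<close>

lemma exp_moment_eq:
  assumes z: "norm z < 1"
  shows "exp_moment z = (1 - exp (- 2 * of_real pi * z)) / (2 * of_real pi ^ 2) *
     (of_real (ln (2 * pi) + euler_mascheroni) * pf_series (\<lambda>n. 1) (z\<^sup>2) + 
      of_real (pi / 2) * (z * pf_series (\<lambda>n. 1 / real (Suc n)) (z\<^sup>2)) + 
      pf_series (\<lambda>n. ln (real (Suc n))) (z\<^sup>2))" (is "_ = ?R z")
proof -
  have hol: "(\<lambda>z. pf_series w (z\<^sup>2)) holomorphic_on ball 0 1" if "pf_series w holomorphic_on ball 0 1" for w
  proof -
    have "(pf_series w \<circ> (\<lambda>z. z\<^sup>2)) holomorphic_on ball 0 1"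
    proof (rule holomorphic_on_compose_gen[OF _ that])
      have "norm (z\<^sup>2) < 1" if "norm z < 1" for z :: complex
      proof -
        have "norm z * norm z < 1 * 1" using that by (intro mult_strict_mono') auto
        thus ?thesis by (simp add: power2_eq_square norm_mult)
      qed
      thus "(\<lambda>z. z\<^sup>2) ` ball 0 1 \<subseteq> ball (0::complex) 1" by (intro image_subsetI) simp
    qed (intro holomorphic_intros)
    thus ?thesis by (simp add: o_def)
  qed
  note h = hol[OF pf_series_holomorphic[OF summable_weights(1) zeta_weight_sums(1)]]
           hol[OF pf_series_holomorphic[OF summable_weights(2) zeta_weight_sums(2)]]
           hol[OF pf_series_holomorphic[OF summable_weights(3) zeta_weight_sums(3)]]
  have "exp_moment z - ?R z = 0"
  \<comment> \<open>The point 1/2 serves as an accumulation point of the segment inside the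
    disc.\<close>
  proof (rule analytic_continuation[where f = "\<lambda>z. exp_moment z - ?R z" and S = "ball 0 1" and U = "of_real ` {0<..<1}" and \<xi> = "1 / 2"])
    show "(\<lambda>z. exp_moment z - ?R z) holomorphic_on ball 0 1"
      by (intro holomorphic_intros h holomorphic_on_subset[OF exp_moment_holomorphic]) auto
    have lim: "(1 / 2 :: real) islimpt {0<..<1}" by (rule interior_limit_point) (simp add: interior_open)
    show "(1 / 2 :: complex) islimpt of_real ` {0<..<1}"
      unfolding islimpt_approachable
    proof (intro allI impI)
      fix e :: real assume "0 < e"
      then obtain x :: real where x: "x \<in> {0<..<1}" "x \<noteq> 1 / 2" "dist x (1 / 2) < e"
        using lim unfolding islimpt_approachable by blast
      have "dist (complex_of_real x) (of_real (1 / 2)) < e" "complex_of_real x \<noteq> of_real (1 / 2)"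
        using x(2,3) by (simp only: dist_of_real) (use x(2) of_real_eq_iff in blast)
      moreover have "complex_of_real (1 / 2) = 1 / 2" by simp
      moreover have "complex_of_real x \<in> complex_of_real ` {0<..<1}" using x(1) by (rule imageI)
      ultimately show "\<exists>x'\<in>complex_of_real ` {0<..<1}. x' \<noteq> 1 / 2 \<and> dist x' (1 / 2) < e"
        by metis
    qed
    show "exp_moment z - ?R z = 0" if "z \<in> of_real ` {0<..<1}" for z
    proof -
      obtain p :: real where p: "z = of_real p" "0 < p" "p < 1" using \<open>z \<in> _\<close> by auto
      show ?thesis unfolding p(1) exp_moment_of_real[OF p(2,3)] by (rule diff_self)
    qed
  qed (use z in \<open>auto simp: norm_divide\<close>)
  thus ?thesis by simp
qed

theorem proposition1:
  fixes p :: real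
  assumes "0 < \<bar>p\<bar>" and "\<bar>p\<bar> < 1"
  shows "interval_lebesgue_integrable lborel 0 1
           (\<lambda>x. of_real (exp (- 2 * pi * p * x)) * deriv (hurwitz_zeta x) 0) \<and>
         summable (\<lambda>n. (- 1) ^ n * zeta (of_nat (2 * n + 2)) * of_real p ^ (2 * n)) \<and>
         summable (\<lambda>n. (- 1) ^ n * zeta (of_nat (2 * n + 3)) * of_real p ^ (2 * n + 1)) \<and>
         summable (\<lambda>n. (- 1) ^ n * deriv zeta (of_nat (2 * n + 2)) * of_real p ^ (2 * n)) \<and>
         of_real (2 * pi ^ 2 / (1 - exp (- 2 * pi * p))) *
           (LBINT x=0..1. of_real (exp (- 2 * pi * p * x)) * deriv (hurwitz_zeta x) 0) =
         of_real (ln (2 * pi) + euler_mascheroni) *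
           (\<Sum>n. (- 1) ^ n * zeta (of_nat (2 * n + 2)) * of_real p ^ (2 * n)) +
         of_real (pi / 2) *
           (\<Sum>n. (- 1) ^ n * zeta (of_nat (2 * n + 3)) * of_real p ^ (2 * n + 1)) -
         (\<Sum>n. (- 1) ^ n * deriv zeta (of_nat (2 * n + 2)) * of_real p ^ (2 * n))"
proof -
  let ?f = "\<lambda>x. of_real (exp (- 2 * pi * p * x)) * deriv (hurwitz_zeta x) 0 :: complex"
  let ?h = "\<lambda>x. indicator {0<..<1} x *\<^sub>R (exp (- 2 * of_real pi * of_real p * of_real x) * of_real (zeta_deriv_0 x)) :: complex"
  let ?z = "of_real p :: complex"
  have u: "norm (?z\<^sup>2) < 1" 
    using assms by (simp add: norm_power abs_square_less_1)
  \<comment> \<open>\<open>einterval 0 1\<close> is the open interval, so the meaningless value of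
    \<open>hurwitz_zeta\<close> at x = 0 never enters.\<close>
  have eq: "(\<lambda>x. indicator (einterval 0 1) x *\<^sub>R ?f x) = ?h"
  proof
    fix x :: real
    show "indicator (einterval 0 1) x *\<^sub>R ?f x = ?h x"
    proof (cases "x \<in> {0<..<1}")
      case True
      thus ?thesis using deriv_hurwitz_zeta_0[of x] by (simp add: einterval_iff exp_of_real[symmetric])
    qed (auto simp: einterval_iff indicator_def)
  qed
  \<comment> \<open>The constant exp (2 pi) bounds the exponential for either sign of p, as |p x| <
    1.\<close>
  have "integrable lborel (\<lambda>x. complex_of_real (exp (2 * pi) * (indicator {0<..<1} x * zeta_deriv_0 x)))"
    using integrable_zeta_deriv_0 by (subst complex_of_real_integrable_eq) simp
  hence int: "integrable lborel ?h"
  proof (rule Bochner_Integration.integrable_bound)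
    have "norm (?h x) \<le> norm (complex_of_real (exp (2 * pi) * (indicator {0<..<1} x * zeta_deriv_0 x)))" for x
    proof (cases "x \<in> {0<..<1}")
      case True
      have "- p * x \<le> 1 * 1" using True assms by (intro mult_mono) auto
      hence "2 * pi * (- p * x) \<le> 2 * pi * 1" by (intro mult_left_mono) auto
      hence "- 2 * pi * p * x \<le> 2 * pi" by (simp add: mult_ac)
      thus ?thesis using True by (simp add: norm_mult mult_right_mono)
    qed auto
    thus "AE x in lborel. norm (?h x) \<le> norm (complex_of_real (exp (2 * pi) * (indicator {0<..<1} x * zeta_deriv_0 x)))"
      by simp
  qed measurable
  have 1: "interval_lebesgue_integrable lborel 0 1 ?f"
    unfolding interval_lebesgue_integrable_def set_integrable_def eq using int by simp
  have I: "(LBINT x=0..1. ?f x) = exp_moment ?z"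
    unfolding interval_lebesgue_integral_def set_lebesgue_integral_def exp_moment_def eq by simp
  have s1: "(\<lambda>n. (- 1) ^ n * zeta (of_nat (2 * n + 2)) * ?z ^ (2 * n)) sums pf_series (\<lambda>n. 1) (?z\<^sup>2)"
    using geometric_partial_fractions_sums(1)[OF summable_weights(1) u zeta_weight_sums(1)]
    by (simp add: pf_series_def power_mult)
  have "(\<lambda>n. ?z * ((- 1) ^ n * zeta (of_nat (2 * n + 3)) * (?z\<^sup>2) ^ n)) sums (?z * pf_series (\<lambda>n. 1 / real (Suc n)) (?z\<^sup>2))"
    unfolding pf_series_def
    by (intro sums_mult geometric_partial_fractions_sums(1)[OF summable_weights(2) u zeta_weight_sums(2)])
  also have "(\<lambda>n. ?z * ((- 1) ^ n * zeta (of_nat (2 * n + 3)) * (?z\<^sup>2) ^ n)) = 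
             (\<lambda>n. (- 1) ^ n * zeta (of_nat (2 * n + 3)) * ?z ^ (2 * n + 1))"
  proof
    fix n
    have "?z ^ (2 * n + 1) = (?z\<^sup>2) ^ n * ?z" by (simp only: power_add power_mult power_one_right)
    thus "?z * ((- 1) ^ n * zeta (of_nat (2 * n + 3)) * (?z\<^sup>2) ^ n) = 
            (- 1) ^ n * zeta (of_nat (2 * n + 3)) * ?z ^ (2 * n + 1)" by (simp only: mult_ac)
  qed
  finally have s2: "(\<lambda>n. (- 1) ^ n * zeta (of_nat (2 * n + 3)) * ?z ^ (2 * n + 1)) sums 
                     (?z * pf_series (\<lambda>n. 1 / real (Suc n)) (?z\<^sup>2))" .
  \<comment> \<open>The weight ln n sums to minus the derivative of zeta, hence the double negation
    here and the final minus sign of the theorem.\<close>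
  have "(\<lambda>n. - ((- 1) ^ n * (- deriv zeta (of_nat (2 * n + 2))) * (?z\<^sup>2) ^ n)) sums (- pf_series (\<lambda>n. ln (real (Suc n))) (?z\<^sup>2))"
    unfolding pf_series_def
    by (intro sums_minus geometric_partial_fractions_sums(1)[OF summable_weights(3) u zeta_weight_sums(3)])
  hence s3: "(\<lambda>n. (- 1) ^ n * deriv zeta (of_nat (2 * n + 2)) * ?z ^ (2 * n)) sums 
                     (- pf_series (\<lambda>n. ln (real (Suc n))) (?z\<^sup>2))"
    by (simp add: power_mult)
  define R where "R = of_real (ln (2 * pi) + euler_mascheroni) * pf_series (\<lambda>n. 1) (?z\<^sup>2) + 
      of_real (pi / 2) * (?z * pf_series (\<lambda>n. 1 / real (Suc n)) (?z\<^sup>2)) + 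
      pf_series (\<lambda>n. ln (real (Suc n))) (?z\<^sup>2)"
  have E: "(1 - exp (- 2 * of_real pi * ?z)) = of_real (1 - exp (- 2 * pi * p))"
    by (simp add: exp_of_real[symmetric])
  \<comment> \<open>Here 0 < |p| enters: the factor multiplied into \<open>exp_moment_eq\<close> can
    be divided out again.\<close>
  have nz: "1 - exp (- 2 * pi * p) \<noteq> 0" using assms by auto
  have "of_real (2 * pi ^ 2 / (1 - exp (- 2 * pi * p))) * exp_moment ?z = R"
  proof -
    have "exp_moment ?z = of_real (1 - exp (- 2 * pi * p)) / (2 * of_real pi ^ 2) * R"
      unfolding R_def E[symmetric] using assms by (intro exp_moment_eq) simp
    also have "\<dots> = of_real ((1 - exp (- 2 * pi * p)) / (2 * pi ^ 2)) * R" by simp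
    finally have "of_real (2 * pi ^ 2 / (1 - exp (- 2 * pi * p))) * exp_moment ?z = 
       of_real (2 * pi ^ 2 / (1 - exp (- 2 * pi * p)) * ((1 - exp (- 2 * pi * p)) / (2 * pi ^ 2))) * R"
      by (simp only: of_real_mult mult.assoc)
    also have "2 * pi ^ 2 / (1 - exp (- 2 * pi * p)) * ((1 - exp (- 2 * pi * p)) / (2 * pi ^ 2)) = 1" 
      using nz by simp
    finally show ?thesis by simp
  qed
  with 1 I s1 s2 s3 show ?thesis
    by (simp only: R_def sums_iff) simp
qed

end
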